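(* Fix $0<p<2$ and $\eta>0$. Then $$\lim_{n\to\infty}\frac{R_n^*(M_{n,p}(\eta))}{\bar R_n^*(M_{n,p}(\eta))}=1.$$
   Context: Observations: $X_i\sim\mathrm{Exp}(\mu_i)$ independent (mean $\mu_i$), $i=1,\dots,n$, with $\mu_i\ge1$. $M_{n,p}(\eta)=\{\mu\in[1,\infty)^n:\frac1n\sum_i\log^p\mu_i\le\eta^p\}$. Minimax risk: $R_n^*(M_{n,p}(\eta))=\inf_{\hat\mu}\sup_{\mu\in M_{n,p}(\eta)}\mathbb{E}_\mu[\frac1n\|\log\hat\mu-\log\mu\|_2^2]$, infimum over estimators with values in $(0,\infty)^n$ (log taken coordinatewise). Minimax-Bayes risk: $\bar R_n^*(M_{n,p}(\eta))=\inf_{\hat\mu}\sup_\pi\{\mathbb{E}_\pi\mathbb{E}_\mu[\frac1n\|\log\hat\mu-\log\mu\|_2^2]:\ \mathbb{E}_\pi[\frac1n\sum_{i=1}^n\log^p\mu_i]\le\eta^p\}$, where the supremum is over prior distributions $\pi$ on $[1,\infty)^n$ for the random vector $\mu$, and given $\mu$ the $X_i$ are independent $\mathrm{Exp}(\mu_i)$. *)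

theory Defs
  imports "HOL-Probability.Probability"
begin

definition obs_model :: "nat \<Rightarrow> (nat \<Rightarrow> real) \<Rightarrow> (nat \<Rightarrow> real) measure" where
  "obs_model n \<mu> = PiM {..<n} (\<lambda>i. density lborel (exponential_density (1 / \<mu> i)))"

definition estimators :: "nat \<Rightarrow> ((nat \<Rightarrow> real) \<Rightarrow> (nat \<Rightarrow> real)) set" where
  "estimators n = {est. (\<forall>i<n. (\<lambda>x. est x i) \<in> borel_measurable (PiM {..<n} (\<lambda>_. lborel)))
                        \<and> (\<forall>x. \<forall>i<n. 0 < est x i)}"

definition log_loss :: "nat \<Rightarrow> (nat \<Rightarrow> real) \<Rightarrow> (nat \<Rightarrow> real) \<Rightarrow> real" where
  "log_loss n a \<mu> = (1 / real n) * (\<Sum>i<n. (ln (a i) - ln (\<mu> i))\<^sup>2)"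

definition risk :: "nat \<Rightarrow> ((nat \<Rightarrow> real) \<Rightarrow> (nat \<Rightarrow> real)) \<Rightarrow> (nat \<Rightarrow> real) \<Rightarrow> ennreal" where
  "risk n est \<mu> = (\<integral>\<^sup>+ x. ennreal (log_loss n (est x) \<mu>) \<partial>obs_model n \<mu>)"

definition Mset :: "nat \<Rightarrow> real \<Rightarrow> real \<Rightarrow> (nat \<Rightarrow> real) set" where
  "Mset n p \<eta> = {\<mu>. (\<forall>i<n. 1 \<le> \<mu> i) \<and>
                     (1 / real n) * (\<Sum>i<n. ln (\<mu> i) powr p) \<le> \<eta> powr p}"

definition priors :: "nat \<Rightarrow> real \<Rightarrow> real \<Rightarrow> (nat \<Rightarrow> real) measure set" where
  "priors n p \<eta> = {\<pi>. prob_space \<pi> \<and> sets \<pi> = sets (PiM {..<n} (\<lambda>_. borel :: real measure))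
      \<and> (AE \<mu> in \<pi>. \<forall>i<n. 1 \<le> \<mu> i)
      \<and> (\<integral>\<^sup>+ \<mu>. ennreal ((1 / real n) * (\<Sum>i<n. ln (\<mu> i) powr p)) \<partial>\<pi>) \<le> ennreal (\<eta> powr p)}"

definition bayes_risk :: "nat \<Rightarrow> ((nat \<Rightarrow> real) \<Rightarrow> (nat \<Rightarrow> real)) \<Rightarrow> (nat \<Rightarrow> real) measure \<Rightarrow> ennreal" where
  "bayes_risk n est \<pi> = (\<integral>\<^sup>+ \<mu>. risk n est \<mu> \<partial>\<pi>)"

definition minimax_risk :: "nat \<Rightarrow> real \<Rightarrow> real \<Rightarrow> ennreal" where
  "minimax_risk n p \<eta> = (INF est\<in>estimators n. SUP \<mu>\<in>Mset n p \<eta>. risk n est \<mu>)"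

definition minimax_bayes_risk :: "nat \<Rightarrow> real \<Rightarrow> real \<Rightarrow> ennreal" where
  "minimax_bayes_risk n p \<eta> = (INF est\<in>estimators n. SUP \<pi>\<in>priors n p \<eta>. bayes_risk n est \<pi>)"

end

theory Submission
  imports Defs
begin

text \<open>
  Let \<open>b\<close> be the maximin Bayes risk of the one-dimensional problem. Both risks converge to \<open>b\<close>.

  The priors obeying the moment constraint are tight, and clamping a decision rule to within
  distance \<open>A\<close> of \<open>ln x\<close> costs at most a tail that is small uniformly in the parameter while making
  the risk bounded and continuous. Hence by Helly's theorem a least favourable prior exists. Its
  posterior mean has Bayes risk at most \<open>b\<close> under every admissible prior, by mixing that prior into
  the least favourable one with vanishing weight. Used coordinatewise, it shows that the
  minimax-Bayes risk is at most \<open>b\<close> for every \<open>n\<close>.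

  Conversely, truncating the least favourable prior and mixing it with the point mass at 1 gives a
  prior of bounded support with slack in the constraint and Bayes risk close to \<open>b\<close>. Its \<open>n\<close>-fold
  product concentrates on the parameter set by Hoeffding's inequality, so the minimax risk is
  eventually larger than any number below \<open>b\<close>.
\<close>

subsection \<open>The one-dimensional problem\<close>

text \<open>Two features of the problem carry the proof. An observation is its mean times standard
  exponential noise, so the error of the rule \<open>ln\<close> has the same law at every parameter;
  finiteness of b and tails uniform in the parameter come from this. And loss and constraint are
  both averages over coordinates, so against a coordinatewise rule a prior on n parameters acts only
  through the average of its marginals.

  The obstacle is a lack of compactness: parameters and loss are unbounded, so the Bayes risk of a
  general rule need not be weakly continuous, and a saddle point has to be built by hand. Perturbing
  the least favourable prior takes the place of an abstract minimax theorem.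

  In the lower bound a product prior meets the constraint only on average. The slack makes the
  probability of exceeding the budget exponentially small, and the bounded support caps the loss
  incurred there. A two-point prior shows that b is positive, without which the limit of the ratio
  could not be formed from the two limits.\<close>

definition expo :: "real \<Rightarrow> real measure" where
  "expo m = density lborel (\<lambda>x. ennreal (exponential_density (1 / m) x))"

text \<open>A rule \<open>d\<close> estimates \<open>ln m\<close>, so it may take any real value;
  \<open>exp\<close> turns it into a positive estimator of \<open>m\<close> with the same log
  loss.\<close>

definition urisk :: "(real \<Rightarrow> real) \<Rightarrow> real \<Rightarrow> ennreal" where
  "urisk d m = (\<integral>\<^sup>+ x. ennreal ((d x - ln m)\<^sup>2) \<partial>expo m)"

definition ubayes :: "(real \<Rightarrow> real) \<Rightarrow> real measure \<Rightarrow> ennreal" where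
  "ubayes d \<pi> = (\<integral>\<^sup>+ m. urisk d m \<partial>\<pi>)"

definition upriors :: "real \<Rightarrow> real \<Rightarrow> real measure set" where
  "upriors p \<eta> = {\<pi>. prob_space \<pi> \<and> sets \<pi> = sets borel \<and> (AE m in \<pi>. 1 \<le> m)
      \<and> (\<integral>\<^sup>+ m. ennreal (ln m powr p) \<partial>\<pi>) \<le> ennreal (\<eta> powr p)}"

definition min_ubayes :: "real measure \<Rightarrow> ennreal" where
  "min_ubayes \<pi> = (INF d\<in>borel_measurable borel. ubayes d \<pi>)"

definition maximin :: "real \<Rightarrow> real \<Rightarrow> ennreal" where
  "maximin p \<eta> = (SUP \<pi>\<in>upriors p \<eta>. min_ubayes \<pi>)"

section \<open>Exponential laws as a scale family\<close>

lemma sets_expo [simp, measurable_cong]: "sets (expo m) = sets borel"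
  by (simp add: expo_def)

lemma space_expo [simp]: "space (expo m) = UNIV"
  by (simp add: expo_def)

lemma prob_space_expo: "0 < m \<Longrightarrow> prob_space (expo m)"
  unfolding expo_def by (rule prob_space_exponential_density) simp

lemma AE_expo_pos: "AE x in expo m. 0 < x"
proof -
  \<comment> \<open>The density need not vanish at 0, so that point is discarded as a null
    set.\<close>
  have "AE x in lborel. x \<noteq> (0::real)"
    using AE_lborel_singleton[of "0::real"] by simp
  then show ?thesis
    unfolding expo_def
    by (subst AE_density) (auto simp: exponential_density_def elim!: eventually_mono)
qed

lemma nn_integral_expo:
  assumes [measurable]: "g \<in> borel_measurable borel"
  shows "(\<integral>\<^sup>+ x. g x \<partial>expo m) = (\<integral>\<^sup>+ x. ennreal (exponential_density (1 / m) x) * g x \<partial>lborel)"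
  unfolding expo_def by (subst nn_integral_density) auto

text \<open>Substitute \<open>x = m * e\<close> in the density integral. Under \<open>expo m\<close>
  the difference \<open>ln x - ln m\<close> thus has the law of \<open>ln e\<close>, whatever
  \<open>m\<close> is; the risk bounds below that are uniform in the parameter rest on this.\<close>

lemma expo_eq_distr:
  assumes "0 < m"
  shows "expo m = distr (expo 1) borel (\<lambda>e. m * e)"
proof (rule measure_eqI)
  fix A assume "A \<in> sets (expo m)"
  then have A [measurable]: "A \<in> sets borel" by simp
  have "emeasure (expo m) A = (\<integral>\<^sup>+ x. indicator A x \<partial>expo m)"
    by simp
  also have "\<dots> = (\<integral>\<^sup>+ x. ennreal (exponential_density (1 / m) x) * indicator A x \<partial>lborel)"
    by (rule nn_integral_expo) simp
  also have "\<dots> = ennreal m * (\<integral>\<^sup>+ x. ennreal (exponential_density (1 / m) (m * x)) * indicator A (m * x) \<partial>lborel)"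
    using assms by (subst nn_integral_real_affine[where c=m and t=0]) auto
  also have "\<dots> = (\<integral>\<^sup>+ x. ennreal (exponential_density (1 / 1) x) * indicator A (m * x) \<partial>lborel)"
    using assms
    by (subst nn_integral_cmult[symmetric])
       (auto intro!: nn_integral_cong split: split_indicator
             simp: exponential_density_def ennreal_mult[symmetric] mult_less_0_iff)
  also have "\<dots> = (\<integral>\<^sup>+ x. indicator A (m * x) \<partial>expo 1)"
    by (rule nn_integral_expo[symmetric]) simp
  also have "\<dots> = (\<integral>\<^sup>+ x. indicator A x \<partial>distr (expo 1) borel (\<lambda>e. m * e))"
    by (subst nn_integral_distr) auto
  finally show "emeasure (expo m) A = emeasure (distr (expo 1) borel (\<lambda>e. m * e)) A"
    by simp
qed simp

lemma urisk_eq_scaled: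
  assumes "0 < m" and [measurable]: "d \<in> borel_measurable borel"
  shows "urisk d m = (\<integral>\<^sup>+ e. ennreal ((d (m * e) - ln m)\<^sup>2) \<partial>expo 1)"
  unfolding urisk_def expo_eq_distr[OF assms(1)] by (subst nn_integral_distr) auto

lemma urisk_eq_density:
  assumes [measurable]: "d \<in> borel_measurable borel"
  shows "urisk d m =
    (\<integral>\<^sup>+ x. ennreal (exponential_density (1 / m) x) * ennreal ((d x - ln m)\<^sup>2) \<partial>lborel)"
  unfolding urisk_def by (rule nn_integral_expo) simp

lemma measurable_urisk [measurable]:
  assumes [measurable]: "d \<in> borel_measurable borel"
  shows "urisk d \<in> borel_measurable borel"
  unfolding urisk_eq_density[OF assms, abs_def] exponential_density_def by measurable

section \<open>Square integrability of the logarithm of a standard exponential variable\<close>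

lemma ln_squared_bound:
  assumes "0 < (x::real)"
  shows "(ln x)\<^sup>2 \<le> 16 * (x powr (1/2) + x powr (-1/2))"
proof -
  have up: "(ln y)\<^sup>2 \<le> 16 * y powr (1/2)" if "1 \<le> y" for y :: real
  proof -
    \<comment> \<open>The exponent 1/4 becomes 1/2 after squaring, which leaves
      \<open>x powr (-1/2)\<close> integrable at 0 when the bound is applied to
      \<open>inverse x\<close>.\<close>
    have "ln y \<le> y powr (1/4) / (1/4)"
      using that by (intro ln_powr_bound) auto
    then have "(ln y)\<^sup>2 \<le> (4 * y powr (1/4))\<^sup>2"
      using that by (intro power_mono) auto
    also have "\<dots> = 16 * y powr (1/2)"
      using that by (simp add: power2_eq_square powr_add[symmetric])
    finally show ?thesis .
  qed
  show ?thesis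
  proof (cases "1 \<le> x")
    case True
    then show ?thesis using up[of x] by (smt (verit) powr_ge_zero)
  next
    case False
    have "(ln x)\<^sup>2 = (ln (inverse x))\<^sup>2"
      using assms by (simp add: ln_inverse)
    also have "\<dots> \<le> 16 * (inverse x) powr (1/2)"
      using False assms by (intro up) (simp add: one_le_inverse)
    also have "(inverse x) powr (1/2) = x powr (-1/2)"
      using assms by (simp add: powr_minus inverse_powr)
    finally show ?thesis by (smt (verit) powr_ge_zero)
  qed
qed

lemma nn_integral_ln_squared_expo_1: "(\<integral>\<^sup>+ e. ennreal ((ln e)\<^sup>2) \<partial>expo 1) < \<infinity>"
proof -
  let ?G = "\<lambda>s t. ennreal (indicator {0..} t * t powr (s - 1) / exp t)"
  have "(\<integral>\<^sup>+ e. ennreal ((ln e)\<^sup>2) \<partial>expo 1) =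
      (\<integral>\<^sup>+ x. ennreal (exponential_density (1 / 1) x) * ennreal ((ln x)\<^sup>2) \<partial>lborel)"
    by (rule nn_integral_expo) simp
  \<comment> \<open>Against \<open>exp (-x)\<close> the two powers are the integrands of
    \<open>Gamma (3/2)\<close> and \<open>Gamma (1/2)\<close>.\<close>
  also have "\<dots> \<le> (\<integral>\<^sup>+ x. 16 * (?G (3/2) x + ?G (1/2) x) \<partial>lborel)"
  proof (rule nn_integral_mono)
    fix x :: real
    show "ennreal (exponential_density (1 / 1) x) * ennreal ((ln x)\<^sup>2)
        \<le> 16 * (?G (3/2) x + ?G (1/2) x)"
    proof (cases "0 < x")
      case True
      have "ennreal (exponential_density (1 / 1) x) * ennreal ((ln x)\<^sup>2) = ennreal (exp (-x) * (ln x)\<^sup>2)"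
        using True by (simp add: exponential_density_def ennreal_mult)
      also have "\<dots> \<le> ennreal (exp (-x) * (16 * (x powr (1/2) + x powr (-1/2))))"
        by (intro ennreal_leI mult_left_mono ln_squared_bound[OF True]) simp
      also have "\<dots> = ennreal (16 * (x powr (1/2) / exp x + x powr (-1/2) / exp x))"
        by (intro arg_cong[where f=ennreal]) (simp add: exp_minus divide_simps)
      also have "\<dots> = ennreal 16 * ennreal (x powr (1/2) / exp x + x powr (-1/2) / exp x)"
        by (rule ennreal_mult) auto
      also have "\<dots> = 16 * (ennreal (x powr (1/2) / exp x) + ennreal (x powr (-1/2) / exp x))"
        by (subst ennreal_plus) auto
      finally show ?thesis using True by simp
    next
      case False
      then show ?thesis by (cases "x = 0") (auto simp: exponential_density_def)
    qed
  qed
  also have "\<dots> = 16 * (ennreal (Gamma (3/2)) + ennreal (Gamma (1/2)))"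
    by (subst nn_integral_cmult, simp, subst nn_integral_add) (auto simp: Gamma_conv_nn_integral_real)
  also have "\<dots> < \<infinity>"
    by (simp add: ennreal_mult_less_top)
  finally show ?thesis .
qed

lemma integrable_ln_squared_expo_1: "integrable (expo 1) (\<lambda>e. (ln e)\<^sup>2)"
  using nn_integral_ln_squared_expo_1 by (intro integrableI_bounded) auto

lemma integrable_ln_shift_squared_expo_1:
  "integrable (expo 1) (\<lambda>e. (\<bar>ln e\<bar> + c)\<^sup>2)"
proof -
  interpret prob_space "expo 1" by (rule prob_space_expo) simp
  show ?thesis
  proof (rule Bochner_Integration.integrable_bound)
    show "integrable (expo 1) (\<lambda>e. 2 * (ln e)\<^sup>2 + 2 * c\<^sup>2)"
      by (intro Bochner_Integration.integrable_add integrable_mult_right integrable_ln_squared_expo_1) simp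
    have "(\<bar>ln e\<bar> + c)\<^sup>2 \<le> 2 * (ln e)\<^sup>2 + 2 * c\<^sup>2" for e :: real
      using sum_squares_bound[of "\<bar>ln e\<bar>" c] by (simp add: power2_sum)
    then show "AE e in expo 1. norm ((\<bar>ln e\<bar> + c)\<^sup>2) \<le> norm (2 * (ln e)\<^sup>2 + 2 * c\<^sup>2)"
      by (intro AE_I2) (smt (verit) real_norm_def zero_le_power2)
  qed simp
qed

subsection \<open>Clamped decision rules\<close>

definition clampd :: "real \<Rightarrow> (real \<Rightarrow> real) \<Rightarrow> real \<Rightarrow> real" where
  "clampd A d x = max (ln x - A) (min (ln x + A) (d x))"

text \<open>The most that clamping at distance \<open>A\<close> can add to a risk, expressed through
  the noise alone. The factor 4 is the square of the 2 that appears in the proof of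
  \<open>clampd_sq_le\<close>.\<close>

definition ln_tail :: "real \<Rightarrow> ennreal" where
  "ln_tail A = (\<integral>\<^sup>+ e. ennreal (if A < \<bar>ln e\<bar> then 4 * (ln e)\<^sup>2 else 0) \<partial>expo 1)"

definition ln_close :: "real \<Rightarrow> (real \<Rightarrow> real) \<Rightarrow> bool" where
  "ln_close A d \<longleftrightarrow> d \<in> borel_measurable borel \<and> (\<forall>x>0. \<bar>d x - ln x\<bar> \<le> A)"

text \<open>With noise \<open>e\<close>, a rule within \<open>A\<close> of \<open>ln x\<close> errs
  by at most \<open>|ln e| + A\<close>; the second moment of this bound is a bound on its risk at
  every parameter.\<close>

definition close_bound :: "real \<Rightarrow> real" where
  "close_bound A = (LINT e|expo 1. (\<bar>ln e\<bar> + A)\<^sup>2)"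

lemma ln_close_clampd:
  "d \<in> borel_measurable borel \<Longrightarrow> 0 \<le> A \<Longrightarrow> ln_close A (clampd A d)"
  unfolding ln_close_def clampd_def by (auto simp: max_def min_def)

text \<open>If \<open>t\<close> lies within \<open>A\<close> of \<open>ln x\<close>, the clamping
  interval contains \<open>t\<close>, and projecting onto an interval never moves a point away from
  a member of it. Otherwise the clamped value is within \<open>A < |ln x - t|\<close> of
  \<open>ln x\<close>, hence within \<open>2 * |ln x - t|\<close> of \<open>t\<close>.\<close>

lemma clampd_sq_le:
  assumes "0 \<le> A"
  shows "(clampd A d x - t)\<^sup>2 \<le> (d x - t)\<^sup>2 + (if A < \<bar>ln x - t\<bar> then 4 * (ln x - t)\<^sup>2 else 0)"
proof (cases "A < \<bar>ln x - t\<bar>")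
  case True
  then have "\<bar>clampd A d x - t\<bar> \<le> \<bar>2 * (ln x - t)\<bar>"
    using assms unfolding clampd_def by (auto simp: max_def min_def abs_if)
  then have "(clampd A d x - t)\<^sup>2 \<le> (2 * (ln x - t))\<^sup>2"
    using abs_le_square_iff by blast
  also have "\<dots> = 4 * (ln x - t)\<^sup>2" by (simp only: power_mult_distrib) simp
  finally show ?thesis using True by (smt (verit) zero_le_power2)
next
  case False
  then have "\<bar>clampd A d x - t\<bar> \<le> \<bar>d x - t\<bar>"
    using assms unfolding clampd_def by (auto simp: max_def min_def abs_if)
  then have "(clampd A d x - t)\<^sup>2 \<le> (d x - t)\<^sup>2"
    using abs_le_square_iff by blast
  then show ?thesis using False by simp
qed

lemma urisk_clampd_le:
  assumes "0 < m" "0 \<le> A" and [measurable]: "d \<in> borel_measurable borel"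
  shows "urisk (clampd A d) m \<le> urisk d m + ln_tail A"
proof -
  have [measurable]: "clampd A d \<in> borel_measurable borel"
    using ln_close_clampd[OF assms(3,2)] by (simp add: ln_close_def)
  have "urisk (clampd A d) m = (\<integral>\<^sup>+ e. ennreal ((clampd A d (m * e) - ln m)\<^sup>2) \<partial>expo 1)"
    by (rule urisk_eq_scaled) (use assms in auto)
  also have "\<dots> \<le> (\<integral>\<^sup>+ e. ennreal ((d (m * e) - ln m)\<^sup>2) +
      ennreal (if A < \<bar>ln e\<bar> then 4 * (ln e)\<^sup>2 else 0) \<partial>expo 1)"
  proof (intro nn_integral_mono_AE, use AE_expo_pos[of 1] in eventually_elim)
    case (elim e)
    have eq: "ln (m * e) - ln m = ln e" using elim assms by (simp add: ln_mult)
    have "ennreal ((clampd A d (m * e) - ln m)\<^sup>2) \<le>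
        ennreal ((d (m * e) - ln m)\<^sup>2 + (if A < \<bar>ln e\<bar> then 4 * (ln e)\<^sup>2 else 0))"
      using clampd_sq_le[OF assms(2), of d "m * e" "ln m"] unfolding eq by (intro ennreal_leI)
    also have "\<dots> = ennreal ((d (m * e) - ln m)\<^sup>2) + ennreal (if A < \<bar>ln e\<bar> then 4 * (ln e)\<^sup>2 else 0)"
      by (rule ennreal_plus) auto
    finally show ?case .
  qed
  also have "\<dots> = urisk d m + ln_tail A"
    unfolding ln_tail_def urisk_eq_scaled[OF assms(1,3)] by (rule nn_integral_add) auto
  finally show ?thesis .
qed

lemma ln_tail_tendsto: "(\<lambda>k. ln_tail (real k)) \<longlonglongrightarrow> 0"
proof -
  have "(\<lambda>k. ln_tail (real k)) \<longlonglongrightarrow> (\<integral>\<^sup>+ e. 0 \<partial>expo 1)"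
    unfolding ln_tail_def
  proof (rule nn_integral_dominated_convergence[where w="\<lambda>e. ennreal (4 * (ln e)\<^sup>2)"])
    show "(\<integral>\<^sup>+ e. ennreal (4 * (ln e)\<^sup>2) \<partial>expo 1) < \<infinity>"
      using nn_integral_ln_squared_expo_1
      by (simp add: ennreal_mult nn_integral_cmult ennreal_mult_less_top)
    show "AE e in expo 1. (\<lambda>k. ennreal (if real k < \<bar>ln e\<bar> then 4 * (ln e)\<^sup>2 else 0)) \<longlonglongrightarrow> 0"
    proof (rule AE_I2)
      fix e :: real
      have "\<forall>\<^sub>F k in sequentially. \<bar>ln e\<bar> \<le> real k"
        by (rule eventually_sequentiallyI[of "nat \<lceil>\<bar>ln e\<bar>\<rceil>"]) linarith
      then have "\<forall>\<^sub>F k in sequentially. ennreal (if real k < \<bar>ln e\<bar> then 4 * (ln e)\<^sup>2 else 0) = 0"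
        by eventually_elim auto
      then show "(\<lambda>k. ennreal (if real k < \<bar>ln e\<bar> then 4 * (ln e)\<^sup>2 else 0)) \<longlonglongrightarrow> 0"
        by (rule tendsto_eventually)
    qed
  qed auto
  then show ?thesis by simp
qed

section \<open>Boundedness and continuity of the risk of rules close to the logarithm\<close>

lemma urisk_ln_close_le:
  assumes "ln_close A d" "0 < m"
  shows "urisk d m \<le> ennreal (close_bound A)"
proof -
  have [measurable]: "d \<in> borel_measurable borel"
    using assms by (simp add: ln_close_def)
  have "urisk d m = (\<integral>\<^sup>+ e. ennreal ((d (m * e) - ln m)\<^sup>2) \<partial>expo 1)"
    by (rule urisk_eq_scaled) (use assms in auto)
  also have "\<dots> \<le> (\<integral>\<^sup>+ e. ennreal ((\<bar>ln e\<bar> + A)\<^sup>2) \<partial>expo 1)"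
  proof (intro nn_integral_mono_AE, use AE_expo_pos[of 1] in eventually_elim)
    case (elim e)
    have "ln (m * e) = ln m + ln e" using elim assms by (simp add: ln_mult)
    moreover have "\<bar>d (m * e) - ln (m * e)\<bar> \<le> A"
      using assms elim by (simp add: ln_close_def)
    ultimately have "\<bar>d (m * e) - ln m\<bar> \<le> \<bar>\<bar>ln e\<bar> + A\<bar>" by linarith
    then show ?case by (intro ennreal_leI) (use abs_le_square_iff in blast)
  qed
  also have "\<dots> = ennreal (close_bound A)"
    unfolding close_bound_def
    by (intro nn_integral_eq_integral integrable_ln_shift_squared_expo_1) auto
  finally show ?thesis .
qed

lemma urisk_ln_close_sequentially:
  assumes d: "ln_close A d" and m: "\<And>k. 1 \<le> m k" "m \<longlonglongrightarrow> l"
  shows "(\<lambda>k. urisk d (m k)) \<longlonglongrightarrow> urisk d l"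
proof -
  have [measurable]: "d \<in> borel_measurable borel"
    using d by (simp add: ln_close_def)
  have l: "1 \<le> l"
    using m(2) by (rule LIMSEQ_le_const) (use m(1) in auto)
  obtain M where M: "\<And>k. m k \<le> M"
    using convergent_imp_Bseq[OF convergentI[OF m(2)]] unfolding Bseq_def
    by (metis abs_le_iff real_norm_def)
  have M1: "1 \<le> M" using M[of 0] m(1)[of 0] by linarith
  let ?f = "\<lambda>m x. ennreal (exponential_density (1 / m) x) * ennreal ((d x - ln m)\<^sup>2)"
  \<comment> \<open>Dominates for all \<open>1 \<le> m \<le> M\<close> at once: for positive
    \<open>x\<close> the density \<open>exp (- x / m) / m\<close> is at most
    \<open>exp (- x / M)\<close>, which is \<open>M\<close> times the density with mean
    \<open>M\<close>, and \<open>ln m\<close> lies between 0 and \<open>ln M\<close>.\<close>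
  let ?w = "\<lambda>x. ennreal (M * exponential_density (1 / M) x) * ennreal ((\<bar>ln x\<bar> + A + ln M)\<^sup>2)"
  have "(\<lambda>k. \<integral>\<^sup>+ x. ?f (m k) x \<partial>lborel) \<longlonglongrightarrow> (\<integral>\<^sup>+ x. ?f l x \<partial>lborel)"
  proof (rule nn_integral_dominated_convergence[where w="?w"])
    show "AE x in lborel. ?f (m k) x \<le> ?w x" for k
    proof -
      have "AE x in lborel. x \<noteq> (0::real)"
        using AE_lborel_singleton[of "0::real"] by simp
      then show ?thesis
      proof eventually_elim
        case (elim x)
        show ?case
        proof (cases "x < 0")
          case True
          then show ?thesis by (simp add: exponential_density_def)
        next
          case False
          with elim have x: "0 < x" by simp
          have "exponential_density (1 / m k) x \<le> M * exponential_density (1 / M) x"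
          proof -
            have "x / M \<le> x / m k" using x M[of k] m(1)[of k] by (intro divide_left_mono) auto
            then have "1 / m k * exp (- (x / m k)) \<le> 1 * exp (- (x / M))"
              using m(1)[of k] by (intro mult_mono) auto
            then show ?thesis using x M1 by (simp add: exponential_density_def)
          qed
          moreover have "(d x - ln (m k))\<^sup>2 \<le> (\<bar>ln x\<bar> + A + ln M)\<^sup>2"
          proof -
            have "0 \<le> ln (m k)" "ln (m k) \<le> ln M" using m(1)[of k] M[of k] by auto
            moreover have "\<bar>d x - ln x\<bar> \<le> A" using d x by (simp add: ln_close_def)
            ultimately have "\<bar>d x - ln (m k)\<bar> \<le> \<bar>\<bar>ln x\<bar> + A + ln M\<bar>" by linarith
            then show ?thesis using abs_le_square_iff by blast
          qed
          ultimately show ?thesis by (intro mult_mono ennreal_leI) auto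
        qed
      qed
    qed
    have w: "(\<integral>\<^sup>+ x. ?w x \<partial>lborel) = ennreal M * (\<integral>\<^sup>+ x. ennreal ((\<bar>ln x\<bar> + A + ln M)\<^sup>2) \<partial>expo M)"
      using M1 by (simp add: nn_integral_expo nn_integral_cmult[symmetric] ennreal_mult' mult.assoc)
    have "(\<integral>\<^sup>+ x. ennreal ((\<bar>ln x\<bar> + A + ln M)\<^sup>2) \<partial>expo M) =
        (\<integral>\<^sup>+ e. ennreal ((\<bar>ln (M * e)\<bar> + A + ln M)\<^sup>2) \<partial>expo 1)"
      using M1 by (subst expo_eq_distr) (auto simp: nn_integral_distr)
    also have "\<dots> \<le> (\<integral>\<^sup>+ e. ennreal ((\<bar>ln e\<bar> + (A + 2 * ln M))\<^sup>2) \<partial>expo 1)"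
    proof (intro nn_integral_mono_AE, use AE_expo_pos[of 1] in eventually_elim)
      case (elim e)
      have "ln (M * e) = ln M + ln e" "0 \<le> ln M" using elim M1 by (simp_all add: ln_mult)
      moreover have "0 \<le> A" using d unfolding ln_close_def by (meson abs_ge_zero order_trans zero_less_one)
      ultimately have "\<bar>\<bar>ln (M * e)\<bar> + A + ln M\<bar> \<le> \<bar>\<bar>ln e\<bar> + (A + 2 * ln M)\<bar>" by linarith
      then show ?case by (intro ennreal_leI) (use abs_le_square_iff in blast)
    qed
    also have "\<dots> < \<infinity>"
      using integrable_ln_shift_squared_expo_1[of "A + 2 * ln M"] by (simp add: integrable_iff_bounded)
    finally have "(\<integral>\<^sup>+ x. ennreal ((\<bar>ln x\<bar> + A + ln M)\<^sup>2) \<partial>expo M) < \<infinity>" .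
    with w show "(\<integral>\<^sup>+ x. ?w x \<partial>lborel) < \<infinity>"
      by (simp add: ennreal_mult_less_top)
    show "AE x in lborel. (\<lambda>k. ?f (m k) x) \<longlonglongrightarrow> ?f l x"
    proof (rule AE_I2)
      fix x :: real
      have "l > 0" using l by simp
      have 1: "(\<lambda>k. exponential_density (1 / m k) x) \<longlonglongrightarrow> exponential_density (1 / l) x"
        unfolding exponential_density_def using m(2) \<open>l > 0\<close>
        by (cases "x < 0") (auto intro!: tendsto_eq_intros)
      have 2: "(\<lambda>k. (d x - ln (m k))\<^sup>2) \<longlonglongrightarrow> (d x - ln l)\<^sup>2"
        using m(2) \<open>l > 0\<close> by (auto intro!: tendsto_intros)
      have eq: "?f m x = ennreal (exponential_density (1 / m) x * (d x - ln m)\<^sup>2)" for m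
        by (rule ennreal_mult'' [symmetric]) simp
      show "(\<lambda>k. ?f (m k) x) \<longlonglongrightarrow> ?f l x"
        unfolding eq by (intro tendsto_ennrealI tendsto_mult 1 2)
    qed
  qed (auto simp: exponential_density_def)
  then show ?thesis
    by (simp add: urisk_eq_density)
qed

text \<open>Weak convergence is tested by bounded continuous functions on the whole line;
  \<open>max 1 m\<close> extends the risk continuously from the half-line on which the priors
  live.\<close>

lemma isCont_urisk_ln_close:
  assumes d: "ln_close A d"
  shows "isCont (\<lambda>m. enn2real (urisk d (max 1 m))) l"
proof (rule continuous_at_sequentiallyI)
  fix u assume u: "u \<longlonglongrightarrow> l"
  have fin: "urisk d (max 1 l) \<noteq> \<infinity>"
    using urisk_ln_close_le[OF d, of "max 1 l"] by (auto simp: top_unique less_max_iff_disj)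
  have "(\<lambda>k. urisk d (max 1 (u k))) \<longlonglongrightarrow> urisk d (max 1 l)"
    by (rule urisk_ln_close_sequentially[OF d]) (auto intro!: tendsto_intros u)
  then have "(\<lambda>k. urisk d (max 1 (u k))) \<longlonglongrightarrow> ennreal (enn2real (urisk d (max 1 l)))"
    using fin by (simp add: ennreal_enn2real less_top)
  then show "(\<lambda>k. enn2real (urisk d (max 1 (u k)))) \<longlonglongrightarrow> enn2real (urisk d (max 1 l))"
    by (rule tendsto_enn2real) simp
qed

subsection \<open>Mixtures and posterior means\<close>

text \<open>Indexed by a general \<open>pmf\<close> to serve two purposes: two-point mixtures of
  priors, and the uniform mixture of the marginals of a prior on n parameters.\<close>

definition mixture :: "'a pmf \<Rightarrow> ('a \<Rightarrow> real measure) \<Rightarrow> real measure" where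
  "mixture q f = measure_pmf q \<bind> f"

lemma
  assumes f: "\<And>i. prob_space (f i)" "\<And>i. sets (f i) = sets borel"
  shows sets_mixture: "sets (mixture q f) = sets borel"
    and prob_space_mixture: "prob_space (mixture q f)"
    and nn_integral_mixture: "g \<in> borel_measurable borel \<Longrightarrow>
          (\<integral>\<^sup>+ m. g m \<partial>mixture q f) = (\<integral>\<^sup>+ i. \<integral>\<^sup>+ m. g m \<partial>f i \<partial>measure_pmf q)"
    and AE_mixture: "Measurable.pred borel P \<Longrightarrow> (\<And>i. AE m in f i. P m) \<Longrightarrow> AE m in mixture q f. P m"
proof -
  have f' [measurable]: "f \<in> measurable (measure_pmf q) (subprob_algebra borel)"
    using f by (auto simp: space_subprob_algebra intro: prob_space_imp_subprob_space)
  show "sets (mixture q f) = sets borel"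
    unfolding mixture_def by (rule sets_bind) (auto simp: f)
  show "prob_space (mixture q f)"
    unfolding mixture_def
    by (rule measure_pmf.prob_space_bind[OF _ f']) (auto simp: f)
  show "(\<integral>\<^sup>+ m. g m \<partial>mixture q f) = (\<integral>\<^sup>+ i. \<integral>\<^sup>+ m. g m \<partial>f i \<partial>measure_pmf q)"
    if "g \<in> borel_measurable borel"
    unfolding mixture_def using that by (rule nn_integral_bind) (rule f')
  show "AE m in mixture q f. P m" if "Measurable.pred borel P" "\<And>i. AE m in f i. P m"
    unfolding mixture_def by (subst AE_bind[OF f' that(1)]) (auto simp: that)
qed

definition mix2 :: "real \<Rightarrow> real measure \<Rightarrow> real measure \<Rightarrow> real measure" where
  "mix2 t \<pi>' \<pi> = mixture (bernoulli_pmf t) (\<lambda>b. if b then \<pi>' else \<pi>)"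

lemma
  assumes t: "0 \<le> t" "t \<le> 1"
    and \<pi>: "prob_space \<pi>" "sets \<pi> = sets borel" and \<pi>': "prob_space \<pi>'" "sets \<pi>' = sets borel"
  shows sets_mix2: "sets (mix2 t \<pi>' \<pi>) = sets borel"
    and prob_space_mix2: "prob_space (mix2 t \<pi>' \<pi>)"
    and nn_integral_mix2: "g \<in> borel_measurable borel \<Longrightarrow>
          (\<integral>\<^sup>+ m. g m \<partial>mix2 t \<pi>' \<pi>) = ennreal t * (\<integral>\<^sup>+ m. g m \<partial>\<pi>') + ennreal (1 - t) * (\<integral>\<^sup>+ m. g m \<partial>\<pi>)"
    and AE_mix2: "Measurable.pred borel P \<Longrightarrow> AE m in \<pi>'. P m \<Longrightarrow> AE m in \<pi>. P m \<Longrightarrow> AE m in mix2 t \<pi>' \<pi>. P m"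
proof -
  have f: "prob_space (if b then \<pi>' else \<pi>)" "sets (if b then \<pi>' else \<pi>) = sets borel" for b
    using \<pi> \<pi>' by auto
  show "sets (mix2 t \<pi>' \<pi>) = sets borel" "prob_space (mix2 t \<pi>' \<pi>)"
    unfolding mix2_def by (rule sets_mixture[OF f] prob_space_mixture[OF f])+
  show "(\<integral>\<^sup>+ m. g m \<partial>mix2 t \<pi>' \<pi>) = ennreal t * (\<integral>\<^sup>+ m. g m \<partial>\<pi>') + ennreal (1 - t) * (\<integral>\<^sup>+ m. g m \<partial>\<pi>)"
    if "g \<in> borel_measurable borel"
    unfolding mix2_def using that t by (simp add: nn_integral_mixture[OF f] mult.commute)
  show "AE m in mix2 t \<pi>' \<pi>. P m"
    if "Measurable.pred borel P" "AE m in \<pi>'. P m" "AE m in \<pi>. P m"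
    unfolding mix2_def by (rule AE_mixture[OF f that(1)]) (use that in simp)
qed

text \<open>The class in which posterior means are studied: any law on [1, \<infinity>), with or
  without a moment constraint.\<close>

definition nprior :: "real measure \<Rightarrow> bool" where
  "nprior \<pi> \<longleftrightarrow> prob_space \<pi> \<and> sets \<pi> = sets borel \<and> (AE m in \<pi>. 1 \<le> m)"

lemma upriors_nprior: "\<pi> \<in> upriors p \<eta> \<Longrightarrow> nprior \<pi>"
  by (auto simp: upriors_def nprior_def)

lemma nprior_mix2:
  assumes t: "0 \<le> t" "t \<le> 1" and \<pi>: "nprior \<pi>" and \<pi>': "nprior \<pi>'"
  shows "nprior (mix2 t \<pi>' \<pi>)"
proof -
  have *: "prob_space \<pi>" "sets \<pi> = sets borel" "prob_space \<pi>'" "sets \<pi>' = sets borel"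
    "AE m in \<pi>. 1 \<le> m" "AE m in \<pi>'. 1 \<le> m"
    using \<pi> \<pi>' by (auto simp: nprior_def)
  show ?thesis
    unfolding nprior_def
    using prob_space_mix2[OF t *(1-4)] sets_mix2[OF t *(1-4)] AE_mix2[OF t *(1-4) _ *(6,5)] by simp
qed

lemma upriors_mix2:
  assumes t: "0 \<le> t" "t \<le> 1" and \<pi>: "\<pi> \<in> upriors p \<eta>" and \<pi>': "\<pi>' \<in> upriors p \<eta>"
  shows "mix2 t \<pi>' \<pi> \<in> upriors p \<eta>"
proof -
  have *: "prob_space \<pi>" "sets \<pi> = sets borel" "prob_space \<pi>'" "sets \<pi>' = sets borel"
    using \<pi> \<pi>' by (auto simp: upriors_def)
  have "(\<integral>\<^sup>+ m. ennreal (ln m powr p) \<partial>mix2 t \<pi>' \<pi>) =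
      ennreal t * (\<integral>\<^sup>+ m. ennreal (ln m powr p) \<partial>\<pi>') + ennreal (1 - t) * (\<integral>\<^sup>+ m. ennreal (ln m powr p) \<partial>\<pi>)"
    by (rule nn_integral_mix2) (use t * in auto)
  also have "\<dots> \<le> ennreal t * ennreal (\<eta> powr p) + ennreal (1 - t) * ennreal (\<eta> powr p)"
    using \<pi> \<pi>' by (intro add_mono mult_left_mono) (auto simp: upriors_def)
  also have "\<dots> = ennreal (\<eta> powr p)"
    using t by (simp add: distrib_right[symmetric] ennreal_plus[symmetric] del: ennreal_plus)
  finally show ?thesis
    using nprior_mix2[OF t upriors_nprior[OF \<pi>] upriors_nprior[OF \<pi>']]
    unfolding upriors_def nprior_def by simp
qed

section \<open>Likelihoods, posterior means and the Bayes rule\<close>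

definition post_weight :: "real \<Rightarrow> real \<Rightarrow> real" where
  "post_weight x m = exp (- (x / m)) / m"

definition post_den :: "real measure \<Rightarrow> real \<Rightarrow> real" where
  "post_den \<pi> x = (LINT m|\<pi>. post_weight x m)"

definition post_num :: "real measure \<Rightarrow> real \<Rightarrow> real" where
  "post_num \<pi> x = (LINT m|\<pi>. ln m * post_weight x m)"

definition post_mean :: "real measure \<Rightarrow> real \<Rightarrow> real" where
  "post_mean \<pi> x = post_num \<pi> x / post_den \<pi> x"

lemma measurable_post_weight [measurable]: "post_weight x \<in> borel_measurable borel"
  unfolding post_weight_def by measurable

lemma post_weight_le:
  assumes "1 \<le> m"
  shows "post_weight x m \<le> exp \<bar>x\<bar> / m"
proof -
  have "\<bar>x\<bar> / m \<le> \<bar>x\<bar> / 1" using assms by (intro divide_left_mono) auto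
  moreover have "(- x) / m \<le> \<bar>x\<bar> / m" using assms by (intro divide_right_mono) auto
  ultimately have "- (x / m) \<le> \<bar>x\<bar>" by simp
  then show ?thesis unfolding post_weight_def using assms by (intro divide_right_mono) auto
qed

lemma post_weight_nonneg: "1 \<le> m \<Longrightarrow> 0 \<le> post_weight x m"
  by (simp add: post_weight_def)

text \<open>The factor \<open>1 / m\<close> of the likelihood outweighs
  \<open>(ln m) ^ j \<le> 4 * m\<close>, so for fixed \<open>x\<close> the integrand is bounded.
  Hence the posterior second moment of \<open>ln m\<close> is finite even where the prior one is
  infinite.\<close>

lemma integrable_post_weight:
  assumes "nprior \<pi>" and j: "j \<le> 2"
  shows "integrable \<pi> (\<lambda>m. (ln m) ^ j * post_weight x m)"
proof -
  interpret prob_space \<pi> using assms by (simp add: nprior_def)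
  have [measurable_cong]: "sets \<pi> = sets borel" using assms by (simp add: nprior_def)
  have ae: "AE m in \<pi>. 1 \<le> m" using assms by (simp add: nprior_def)
  show ?thesis
  proof (rule integrable_const_bound[where B="4 * exp \<bar>x\<bar>"])
    show "AE m in \<pi>. norm ((ln m) ^ j * post_weight x m) \<le> 4 * exp \<bar>x\<bar>"
      using ae
    proof eventually_elim
      case (elim m)
      have "(ln m) ^ j \<le> 4 * m"
      proof -
        consider "j = 0" | "j = 1" | "j = 2" using j by linarith
        then show ?thesis
        proof cases
          case 2
          then show ?thesis using ln_le_minus_one[of m] elim by simp
        next
          case 3
          \<comment> \<open>Passing to \<open>sqrt m\<close> before applying
            \<open>ln y \<le> y\<close> yields \<open>(ln m)\<^sup>2 \<le> 4 * m\<close>, the source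
            of the constant 4.\<close>
          have "ln m = 2 * ln (sqrt m)" using elim by (simp add: ln_sqrt)
          also have "\<dots> \<le> 2 * sqrt m" using ln_le_minus_one[of "sqrt m"] elim by simp
          finally have "(ln m)\<^sup>2 \<le> (2 * sqrt m)\<^sup>2" using elim by (intro power_mono) auto
          then show ?thesis using 3 elim by (simp add: power_mult_distrib)
        qed (use elim in simp)
      qed
      then have "(ln m) ^ j * post_weight x m \<le> 4 * m * (exp \<bar>x\<bar> / m)"
        using post_weight_le[OF elim, of x] elim
        by (intro mult_mono) (auto simp: post_weight_def)
      then show ?case using elim by (simp add: post_weight_def)
    qed
  qed measurable
qed

text \<open>\<open>post_weight x\<close> omits the cut-off of the density at negative
  \<open>x\<close>, so it is positive for every real \<open>x\<close> once \<open>m \<ge> 1\<close>;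
  the quotient \<open>post_mean\<close> then never divides by 0.\<close>

lemma post_den_pos:
  assumes "nprior \<pi>"
  shows "0 < post_den \<pi> x"
proof -
  interpret prob_space \<pi> using assms by (simp add: nprior_def)
  have [measurable_cong]: "sets \<pi> = sets borel" using assms by (simp add: nprior_def)
  have ae: "AE m in \<pi>. 0 < post_weight x m"
    using assms by (auto simp: nprior_def post_weight_def elim!: eventually_mono)
  have "post_den \<pi> x \<noteq> 0"
  proof
    assume "post_den \<pi> x = 0"
    then have "AE m in \<pi>. post_weight x m = 0"
      unfolding post_den_def using integrable_post_weight[OF assms, of 0 x] ae
      by (subst (asm) integral_nonneg_eq_0_iff_AE) (auto elim!: eventually_mono)
    with ae have "AE m in \<pi>. False" by eventually_elim simp
    then show False by simp
  qed
  moreover have "0 \<le> post_den \<pi> x"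
    unfolding post_den_def using ae by (intro integral_nonneg_AE) (auto elim!: eventually_mono)
  ultimately show ?thesis by simp
qed

lemma measurable_post_mean [measurable]:
  assumes "nprior \<pi>"
  shows "post_mean \<pi> \<in> borel_measurable borel"
proof -
  interpret prob_space \<pi> using assms by (simp add: nprior_def)
  have [measurable_cong]: "sets \<pi> = sets borel" using assms by (simp add: nprior_def)
  show ?thesis
    unfolding post_mean_def[abs_def] post_num_def post_den_def post_weight_def
    by (intro borel_measurable_divide borel_measurable_lebesgue_integral) simp_all
qed

lemma posterior_quadratic:
  assumes "nprior \<pi>"
  shows "(\<integral>\<^sup>+ m. ennreal (post_weight x m) * ennreal ((a - ln m)\<^sup>2) \<partial>\<pi>) =
    ennreal (a\<^sup>2 * post_den \<pi> x - 2 * a * post_num \<pi> x + (LINT m|\<pi>. (ln m)\<^sup>2 * post_weight x m))"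
proof -
  note i = integrable_post_weight[OF assms, of 0 x, simplified]
    integrable_post_weight[OF assms, of 1 x, simplified] integrable_post_weight[OF assms, of 2 x, simplified]
  have ae: "AE m in \<pi>. 0 \<le> post_weight x m"
    using assms by (auto simp: nprior_def post_weight_def elim!: eventually_mono)
  have eq: "post_weight x m * (a - ln m)\<^sup>2 =
      a\<^sup>2 * post_weight x m - 2 * a * (ln m * post_weight x m) + (ln m)\<^sup>2 * post_weight x m" for m
    by (simp add: power2_eq_square algebra_simps)
  have int: "integrable \<pi> (\<lambda>m. post_weight x m * (a - ln m)\<^sup>2)"
    unfolding eq by (intro Bochner_Integration.integrable_add Bochner_Integration.integrable_diff
        integrable_mult_right i)
  have "(\<integral>\<^sup>+ m. ennreal (post_weight x m) * ennreal ((a - ln m)\<^sup>2) \<partial>\<pi>) =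
      (\<integral>\<^sup>+ m. ennreal (post_weight x m * (a - ln m)\<^sup>2) \<partial>\<pi>)"
    by (simp add: ennreal_mult'')
  also have "\<dots> = ennreal (LINT m|\<pi>. post_weight x m * (a - ln m)\<^sup>2)"
    using ae by (intro nn_integral_eq_integral int) (auto elim!: eventually_mono)
  also have "(LINT m|\<pi>. post_weight x m * (a - ln m)\<^sup>2) =
      a\<^sup>2 * post_den \<pi> x - 2 * a * post_num \<pi> x + (LINT m|\<pi>. (ln m)\<^sup>2 * post_weight x m)"
    unfolding eq post_den_def post_num_def using i by simp
  finally show ?thesis .
qed

lemma post_mean_minimizes:
  assumes "nprior \<pi>"
  shows "(\<integral>\<^sup>+ m. ennreal (post_weight x m) * ennreal ((post_mean \<pi> x - ln m)\<^sup>2) \<partial>\<pi>)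
    \<le> (\<integral>\<^sup>+ m. ennreal (post_weight x m) * ennreal ((a - ln m)\<^sup>2) \<partial>\<pi>)"
proof -
  let ?D = "post_den \<pi> x" and ?N = "post_num \<pi> x"
  have pos: "0 < ?D" by (rule post_den_pos[OF assms])
  \<comment> \<open>Completing the square: this is the excess of the quadratic in
    \<open>posterior_quadratic\<close> at \<open>a\<close> over its value at
    \<open>?N / ?D\<close>.\<close>
  have "0 \<le> ?D * (a - ?N / ?D)\<^sup>2" using pos by simp
  also have "\<dots> = (a\<^sup>2 * ?D - 2 * a * ?N) - ((?N / ?D)\<^sup>2 * ?D - 2 * (?N / ?D) * ?N)"
    using pos by (simp add: power2_eq_square field_simps)
  finally show ?thesis
    unfolding posterior_quadratic[OF assms] by (intro ennreal_leI) (simp add: post_mean_def)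
qed

text \<open>Fubini exchanges parameter and observation, so that minimising over rules becomes a
  separate minimisation over the number \<open>d x\<close> for each \<open>x\<close>. The indicator
  restores the cut-off that \<open>post_weight\<close> omits.\<close>

lemma ubayes_eq_posterior:
  assumes "nprior \<pi>" and [measurable]: "d \<in> borel_measurable borel"
  shows "ubayes d \<pi> = (\<integral>\<^sup>+ x. indicator {0..} x *
      (\<integral>\<^sup>+ m. ennreal (post_weight x m) * ennreal ((d x - ln m)\<^sup>2) \<partial>\<pi>) \<partial>lborel)"
proof -
  interpret prob_space \<pi> using assms by (simp add: nprior_def)
  have [measurable_cong]: "sets \<pi> = sets borel" using assms by (simp add: nprior_def)
  interpret pair_sigma_finite \<pi> lborel ..
  have eq: "ennreal (exponential_density (1 / m) x) = indicator {0..} x * ennreal (post_weight x m)" for x m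
    by (auto simp: exponential_density_def post_weight_def split: split_indicator)
  have "ubayes d \<pi> = (\<integral>\<^sup>+ m. \<integral>\<^sup>+ x. indicator {0..} x * ennreal (post_weight x m) * ennreal ((d x - ln m)\<^sup>2) \<partial>lborel \<partial>\<pi>)"
    unfolding ubayes_def urisk_eq_density[OF assms(2)] eq ..
  also have "\<dots> = (\<integral>\<^sup>+ x. \<integral>\<^sup>+ m. indicator {0..} x * ennreal (post_weight x m) * ennreal ((d x - ln m)\<^sup>2) \<partial>\<pi> \<partial>lborel)"
    by (intro Fubini'[symmetric]) (unfold post_weight_def, measurable)
  also have "\<dots> = (\<integral>\<^sup>+ x. indicator {0..} x *
      (\<integral>\<^sup>+ m. ennreal (post_weight x m) * ennreal ((d x - ln m)\<^sup>2) \<partial>\<pi>) \<partial>lborel)"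
    by (simp add: mult.assoc nn_integral_cmult)
  finally show ?thesis .
qed

lemma min_ubayes_eq:
  assumes "nprior \<pi>"
  shows "min_ubayes \<pi> = ubayes (post_mean \<pi>) \<pi>"
  unfolding min_ubayes_def
proof (rule antisym)
  show "(INF d\<in>borel_measurable borel. ubayes d \<pi>) \<le> ubayes (post_mean \<pi>) \<pi>"
    by (rule INF_lower) (rule measurable_post_mean[OF assms])
  show "ubayes (post_mean \<pi>) \<pi> \<le> (INF d\<in>borel_measurable borel. ubayes d \<pi>)"
    by (rule INF_greatest)
       (auto simp: ubayes_eq_posterior assms measurable_post_mean
             intro!: nn_integral_mono mult_left_mono post_mean_minimizes)
qed

section \<open>Perturbation of a prior and of its posterior mean\<close>

lemma ubayes_mix2:
  assumes t: "0 \<le> t" "t \<le> 1"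
    and \<pi>: "nprior \<pi>" and \<pi>': "nprior \<pi>'" and [measurable]: "d \<in> borel_measurable borel"
  shows "ubayes d (mix2 t \<pi>' \<pi>) = ennreal t * ubayes d \<pi>' + ennreal (1 - t) * ubayes d \<pi>"
  unfolding ubayes_def by (rule nn_integral_mix2) (use assms in \<open>auto simp: nprior_def\<close>)

lemma integral_mix2:
  fixes g :: "real \<Rightarrow> real"
  assumes t: "0 \<le> t" "t \<le> 1" and \<pi>: "nprior \<pi>" and \<pi>': "nprior \<pi>'"
    and [measurable]: "g \<in> borel_measurable borel" and g: "integrable \<pi> g" "integrable \<pi>' g"
    and nn: "\<And>m. 1 \<le> m \<Longrightarrow> 0 \<le> g m"
  shows "integral\<^sup>L (mix2 t \<pi>' \<pi>) g = t * integral\<^sup>L \<pi>' g + (1 - t) * integral\<^sup>L \<pi> g"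
proof -
  have mx: "nprior (mix2 t \<pi>' \<pi>)" by (rule nprior_mix2[OF t \<pi> \<pi>'])
  have ae: "AE m in \<rho>. 0 \<le> g m" if "nprior \<rho>" for \<rho>
    using that nn by (auto simp: nprior_def elim!: eventually_mono)
  have [measurable]: "g \<in> borel_measurable (mix2 t \<pi>' \<pi>)"
    using mx by (simp add: nprior_def cong: measurable_cong_sets)
  have "(\<integral>\<^sup>+ m. ennreal (g m) \<partial>mix2 t \<pi>' \<pi>) =
      ennreal t * (\<integral>\<^sup>+ m. ennreal (g m) \<partial>\<pi>') + ennreal (1 - t) * (\<integral>\<^sup>+ m. ennreal (g m) \<partial>\<pi>)"
    by (rule nn_integral_mix2) (use t \<pi> \<pi>' in \<open>auto simp: nprior_def\<close>)
  also have "\<dots> = ennreal t * ennreal (integral\<^sup>L \<pi>' g) + ennreal (1 - t) * ennreal (integral\<^sup>L \<pi> g)"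
    using g \<pi> \<pi>' by (simp add: nn_integral_eq_integral ae)
  also have "\<dots> = ennreal (t * integral\<^sup>L \<pi>' g + (1 - t) * integral\<^sup>L \<pi> g)"
    using t \<pi> \<pi>' by (simp add: ennreal_mult ennreal_plus integral_nonneg_AE ae)
  finally have "enn2real (\<integral>\<^sup>+ m. ennreal (g m) \<partial>mix2 t \<pi>' \<pi>) = t * integral\<^sup>L \<pi>' g + (1 - t) * integral\<^sup>L \<pi> g"
    using t \<pi> \<pi>' by (simp add: integral_nonneg_AE ae del: ennreal_plus)
  then show ?thesis
    by (subst integral_eq_nn_integral) (auto simp: ae mx)
qed

text \<open>Numerator and denominator of the posterior mean are integrals against the prior, hence
  affine in the mixing weight, and the limiting denominator is positive.\<close>

lemma post_mean_mix2_tendsto: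
  assumes \<pi>: "nprior \<pi>" and \<pi>': "nprior \<pi>'"
    and t: "\<And>k. 0 \<le> t k" "\<And>k. t k \<le> 1" "t \<longlonglongrightarrow> 0"
  shows "(\<lambda>k. post_mean (mix2 (t k) \<pi>' \<pi>) x) \<longlonglongrightarrow> post_mean \<pi> x"
proof -
  have den: "post_den (mix2 (t k) \<pi>' \<pi>) x = t k * post_den \<pi>' x + (1 - t k) * post_den \<pi> x" for k
    unfolding post_den_def
    using integrable_post_weight[OF \<pi>, of 0 x] integrable_post_weight[OF \<pi>', of 0 x]
    by (intro integral_mix2 t \<pi> \<pi>') (auto intro!: post_weight_nonneg mult_nonneg_nonneg)
  have num: "post_num (mix2 (t k) \<pi>' \<pi>) x = t k * post_num \<pi>' x + (1 - t k) * post_num \<pi> x" for k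
    unfolding post_num_def
    using integrable_post_weight[OF \<pi>, of 1 x] integrable_post_weight[OF \<pi>', of 1 x]
    by (intro integral_mix2 t \<pi> \<pi>') (auto intro!: post_weight_nonneg mult_nonneg_nonneg)
  have "(\<lambda>k. (t k * post_num \<pi>' x + (1 - t k) * post_num \<pi> x) / (t k * post_den \<pi>' x + (1 - t k) * post_den \<pi> x))
     \<longlonglongrightarrow> (0 * post_num \<pi>' x + (1 - 0) * post_num \<pi> x) / (0 * post_den \<pi>' x + (1 - 0) * post_den \<pi> x)"
    using post_den_pos[OF \<pi>, of x] by (intro tendsto_intros t(3)) auto
  then show ?thesis by (simp add: post_mean_def den num)
qed

text \<open>Fatou's lemma twice, under the law of the observation and then under the prior. An upper
  bound is all that has to survive the limit.\<close>

lemma ubayes_liminf: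
  assumes \<pi>: "nprior \<pi>" and [measurable]: "\<And>k. d k \<in> borel_measurable borel" "d' \<in> borel_measurable borel"
    and conv: "\<And>x. (\<lambda>k. d k x) \<longlonglongrightarrow> d' x" and le: "\<And>k. ubayes (d k) \<pi> \<le> b"
  shows "ubayes d' \<pi> \<le> b"
proof -
  interpret prob_space \<pi> using assms by (simp add: nprior_def)
  have [measurable_cong]: "sets \<pi> = sets borel" using assms by (simp add: nprior_def)
  have 1: "urisk d' m \<le> liminf (\<lambda>k. urisk (d k) m)" for m
  proof -
    have "urisk d' m = (\<integral>\<^sup>+ x. liminf (\<lambda>k. ennreal ((d k x - ln m)\<^sup>2)) \<partial>expo m)"
      unfolding urisk_def
      by (intro nn_integral_cong lim_imp_Liminf[symmetric] tendsto_ennrealI tendsto_intros conv) auto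
    also have "\<dots> \<le> liminf (\<lambda>k. urisk (d k) m)"
      unfolding urisk_def by (rule nn_integral_liminf) auto
    finally show ?thesis .
  qed
  have "ubayes d' \<pi> \<le> (\<integral>\<^sup>+ m. liminf (\<lambda>k. urisk (d k) m) \<partial>\<pi>)"
    unfolding ubayes_def by (intro nn_integral_mono 1)
  also have "\<dots> \<le> liminf (\<lambda>k. ubayes (d k) \<pi>)"
    unfolding ubayes_def by (rule nn_integral_liminf) auto
  also have "\<dots> \<le> b"
    using le by (intro order_trans[OF Liminf_le_Limsup] Limsup_bounded) auto
  finally show ?thesis .
qed

text \<open>
  If \<open>d\<close> is Bayes for \<open>(1 - t) \<pi> + t \<pi>'\<close>, then \<open>b \<ge> (1 - t) B(d, \<pi>) + t B(d, \<pi>') \<ge> (1 - t) b + t B(d, \<pi>')\<close>,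
  hence \<open>B(d, \<pi>') \<le> b\<close>. Fatou's lemma transfers this to the limit \<open>t \<rightarrow> 0\<close>.
\<close>

theorem least_favourable_minimax:
  assumes \<pi>: "\<pi> \<in> upriors p \<eta>" and lf: "maximin p \<eta> \<le> min_ubayes \<pi>"
    and fin: "maximin p \<eta> < \<infinity>" and \<pi>': "\<pi>' \<in> upriors p \<eta>"
  shows "ubayes (post_mean \<pi>) \<pi>' \<le> maximin p \<eta>"
proof -
  define t where "t k = inverse (real (Suc k))" for k
  have t: "0 < t k" "t k \<le> 1" for k
    by (auto simp: t_def field_simps)
  note n = upriors_nprior[OF \<pi>] upriors_nprior[OF \<pi>']
  have nm: "nprior (mix2 (t k) \<pi>' \<pi>)" for k
    by (rule nprior_mix2) (use t[of k] n in auto)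
  have ms: "post_mean (mix2 (t k) \<pi>' \<pi>) \<in> borel_measurable borel" for k
    by (rule measurable_post_mean[OF nm])
  have conv: "(\<lambda>k. post_mean (mix2 (t k) \<pi>' \<pi>) x) \<longlonglongrightarrow> post_mean \<pi> x" for x
  proof (rule post_mean_mix2_tendsto[OF n])
    show "t \<longlonglongrightarrow> 0"
      unfolding t_def by (rule LIMSEQ_inverse_real_of_nat)
  qed (use t in \<open>auto intro: less_imp_le\<close>)
  have le: "ubayes (post_mean (mix2 (t k) \<pi>' \<pi>)) \<pi>' \<le> maximin p \<eta>" for k
  proof -
    let ?d = "post_mean (mix2 (t k) \<pi>' \<pi>)" and ?b = "maximin p \<eta>"
    have "ennreal (t k) * ubayes ?d \<pi>' + ennreal (1 - t k) * ?b
        \<le> ennreal (t k) * ubayes ?d \<pi>' + ennreal (1 - t k) * ubayes ?d \<pi>"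
    proof (intro add_left_mono mult_left_mono)
      have "min_ubayes \<pi> \<le> ubayes ?d \<pi>" unfolding min_ubayes_def by (intro INF_lower ms)
      with lf show "?b \<le> ubayes ?d \<pi>" by (rule order_trans)
    qed simp
    also have "\<dots> = ubayes ?d (mix2 (t k) \<pi>' \<pi>)"
      by (rule ubayes_mix2[symmetric]) (use t[of k] n ms in auto)
    also have "\<dots> = min_ubayes (mix2 (t k) \<pi>' \<pi>)"
      by (rule min_ubayes_eq[symmetric, OF nm])
    also have "\<dots> \<le> ?b"
      unfolding maximin_def by (intro SUP_upper upriors_mix2) (use t[of k] \<pi> \<pi>' in auto)
    also have "?b = ennreal (t k) * ?b + ennreal (1 - t k) * ?b"
      using t[of k] by (simp add: distrib_right[symmetric] ennreal_plus[symmetric] del: ennreal_plus)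
    \<comment> \<open>Cancelling \<open>ennreal (1 - t k) * ?b\<close> requires it to be finite; the
      factor \<open>t k\<close> that remains is cancelled because it is positive.\<close>
    finally have "ennreal (t k) * ubayes ?d \<pi>' \<le> ennreal (t k) * ?b"
      unfolding add.commute[of _ "ennreal (1 - t k) * ?b"] ennreal_add_left_cancel_le
      using fin by (auto simp: ennreal_mult_eq_top_iff)
    then show ?thesis
      using t[of k] by (simp add: ennreal_mult_le_mult_iff)
  qed
  show ?thesis
    by (rule ubayes_liminf[OF n(2) ms measurable_post_mean[OF n(1)] conv le])
qed

subsection \<open>Least favourable priors\<close>

lemma ln_close_ln: "ln_close 0 ln"
  by (simp add: ln_close_def)

lemma ubayes_ln_close_le:
  assumes "nprior \<pi>" "ln_close A d"
  shows "ubayes d \<pi> \<le> ennreal (close_bound A)"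
proof -
  interpret prob_space \<pi> using assms by (simp add: nprior_def)
  have "AE m in \<pi>. urisk d m \<le> ennreal (close_bound A)"
    using assms by (auto simp: nprior_def elim!: eventually_mono intro!: urisk_ln_close_le)
  then have "ubayes d \<pi> \<le> (\<integral>\<^sup>+ m. ennreal (close_bound A) \<partial>\<pi>)"
    unfolding ubayes_def by (rule nn_integral_mono_AE)
  then show ?thesis by (simp add: emeasure_space_1)
qed

lemma ubayes_clampd_le:
  assumes "nprior \<pi>" "0 \<le> A" and [measurable]: "d \<in> borel_measurable borel"
  shows "ubayes (clampd A d) \<pi> \<le> ubayes d \<pi> + ln_tail A"
proof -
  interpret prob_space \<pi> using assms by (simp add: nprior_def)
  have [measurable_cong]: "sets \<pi> = sets borel" using assms by (simp add: nprior_def)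
  have "AE m in \<pi>. urisk (clampd A d) m \<le> urisk d m + ln_tail A"
    using assms by (auto simp: nprior_def elim!: eventually_mono intro!: urisk_clampd_le)
  then have "ubayes (clampd A d) \<pi> \<le> (\<integral>\<^sup>+ m. urisk d m + ln_tail A \<partial>\<pi>)"
    unfolding ubayes_def by (rule nn_integral_mono_AE)
  also have "\<dots> = ubayes d \<pi> + ln_tail A"
    unfolding ubayes_def by (subst nn_integral_add) (auto simp: emeasure_space_1)
  finally show ?thesis .
qed

text \<open>The rule \<open>ln\<close> errs by \<open>ln e\<close> at every parameter, so the second
  moment of \<open>ln e\<close> bounds its Bayes risk under every prior.\<close>

lemma maximin_finite: "maximin p \<eta> < \<infinity>"
proof -
  have "maximin p \<eta> \<le> ennreal (close_bound 0)"
    unfolding maximin_def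
  proof (rule SUP_least)
    fix \<pi> assume "\<pi> \<in> upriors p \<eta>"
    then have "nprior \<pi>" by (rule upriors_nprior)
    have "min_ubayes \<pi> \<le> ubayes ln \<pi>"
      unfolding min_ubayes_def by (rule INF_lower) simp
    also have "\<dots> \<le> ennreal (close_bound 0)"
      by (rule ubayes_ln_close_le[OF \<open>nprior \<pi>\<close> ln_close_ln])
    finally show "min_ubayes \<pi> \<le> ennreal (close_bound 0)" .
  qed
  also have "\<dots> < \<infinity>" by simp
  finally show ?thesis .
qed

lemma upriors_return:
  assumes "1 \<le> c" "ln c powr p \<le> \<eta> powr p"
  shows "return borel c \<in> upriors p \<eta>"
  using assms unfolding upriors_def
  by (auto simp: AE_return nn_integral_return intro!: prob_space_return)

text \<open>For \<open>c \<ge> 1\<close> the density with mean \<open>c\<close> is at least the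
  standard one divided by \<open>c\<close>. Risks at different parameters can thereby be compared
  under the single law \<open>expo 1\<close>.\<close>

lemma urisk_ge:
  assumes "1 \<le> c" and [measurable]: "d \<in> borel_measurable borel"
  shows "(\<integral>\<^sup>+ x. ennreal ((d x - ln c)\<^sup>2 / c) \<partial>expo 1) \<le> urisk d c"
proof -
  have "(\<integral>\<^sup>+ x. ennreal ((d x - ln c)\<^sup>2 / c) \<partial>expo 1) =
      (\<integral>\<^sup>+ x. ennreal (exponential_density (1 / 1) x) * ennreal ((d x - ln c)\<^sup>2 / c) \<partial>lborel)"
    by (rule nn_integral_expo) simp
  also have "\<dots> \<le> (\<integral>\<^sup>+ x. ennreal (exponential_density (1 / c) x) * ennreal ((d x - ln c)\<^sup>2) \<partial>lborel)"
  proof (rule nn_integral_mono)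
    fix x :: real
    have "exponential_density (1 / 1) x / c \<le> exponential_density (1 / c) x"
    proof (cases "x < 0")
      case False
      have "x / c \<le> x / 1" using False assms by (intro divide_left_mono) auto
      then show ?thesis using False assms
        by (simp add: exponential_density_def divide_right_mono)
    qed (simp add: exponential_density_def)
    then have "exponential_density (1 / 1) x / c * (d x - ln c)\<^sup>2 \<le> exponential_density (1 / c) x * (d x - ln c)\<^sup>2"
      by (rule mult_right_mono) simp
    then show "ennreal (exponential_density (1 / 1) x) * ennreal ((d x - ln c)\<^sup>2 / c)
        \<le> ennreal (exponential_density (1 / c) x) * ennreal ((d x - ln c)\<^sup>2)"
      using assms by (simp add: ennreal_mult''[symmetric] ennreal_leI)
  qed
  also have "\<dots> = urisk d c" by (simp add: urisk_eq_density)
  finally show ?thesis .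
qed

text \<open>Two-point argument: under a common reference law no rule is close to both
  \<open>ln 1 = 0\<close> and \<open>ln c\<close>. With \<open>c = exp \<eta>\<close> the point mass
  at \<open>c\<close> uses exactly the whole budget, so its equal mixture with the point mass at 1
  is admissible.\<close>

lemma maximin_pos:
  assumes "0 < p" "0 < \<eta>"
  shows "0 < maximin p \<eta>"
proof -
  define c where "c = exp \<eta>"
  have c: "1 \<le> c" "ln c = \<eta>" using assms by (auto simp: c_def)
  define \<pi> where "\<pi> = mix2 (1/2) (return borel c) (return borel 1)"
  have r: "return borel c \<in> upriors p \<eta>" "return borel 1 \<in> upriors p \<eta>"
    using c assms by (auto intro!: upriors_return)
  have \<pi>: "\<pi> \<in> upriors p \<eta>"
    unfolding \<pi>_def by (rule upriors_mix2) (use r in auto)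
  interpret E: prob_space "expo 1" by (rule prob_space_expo) simp
  have "ennreal (1/2) * ennreal (\<eta>\<^sup>2 / (2 * c)) \<le> ubayes d \<pi>"
    if [measurable]: "d \<in> borel_measurable borel" for d
  proof -
    have "ennreal (\<eta>\<^sup>2 / (2 * c)) = (\<integral>\<^sup>+ x. ennreal (\<eta>\<^sup>2 / (2 * c)) \<partial>expo 1)"
      by (simp add: E.emeasure_space_1[simplified])
    also have "\<dots> \<le> (\<integral>\<^sup>+ x. ennreal ((d x - ln c)\<^sup>2 / c) + ennreal ((d x - ln 1)\<^sup>2 / 1) \<partial>expo 1)"
    proof (rule nn_integral_mono)
      fix x
      have "\<eta>\<^sup>2 / 2 \<le> (d x - \<eta>)\<^sup>2 + (d x)\<^sup>2"
        using zero_le_power2[of "2 * d x - \<eta>"] by (simp add: power2_eq_square algebra_simps)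
      then have "\<eta>\<^sup>2 / 2 / c \<le> ((d x - \<eta>)\<^sup>2 + (d x)\<^sup>2) / c"
        using c by (intro divide_right_mono) auto
      also have "\<dots> \<le> (d x - \<eta>)\<^sup>2 / c + (d x)\<^sup>2 / 1"
        unfolding add_divide_distrib using c by (intro add_left_mono divide_left_mono) auto
      finally show "ennreal (\<eta>\<^sup>2 / (2 * c)) \<le> ennreal ((d x - ln c)\<^sup>2 / c) + ennreal ((d x - ln 1)\<^sup>2 / 1)"
        using c by (intro order_trans[OF ennreal_leI eq_refl[OF ennreal_plus]]) auto
    qed
    also have "\<dots> = (\<integral>\<^sup>+ x. ennreal ((d x - ln c)\<^sup>2 / c) \<partial>expo 1) + (\<integral>\<^sup>+ x. ennreal ((d x - ln 1)\<^sup>2 / 1) \<partial>expo 1)"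
      by (rule nn_integral_add) auto
    also have "\<dots> \<le> urisk d c + urisk d 1"
      using c by (intro add_mono urisk_ge) auto
    finally have "ennreal (1/2) * ennreal (\<eta>\<^sup>2 / (2 * c)) \<le> ennreal (1/2) * (urisk d c + urisk d 1)"
      by (rule mult_left_mono) simp
    also have "\<dots> = ennreal (1/2) * ubayes d (return borel c) + ennreal (1 - 1/2) * ubayes d (return borel 1)"
      by (simp add: ubayes_def nn_integral_return distrib_left)
    also have "\<dots> = ubayes d \<pi>"
      unfolding \<pi>_def by (rule ubayes_mix2[symmetric]) (use r upriors_nprior in auto)
    finally show ?thesis .
  qed
  then have "ennreal (1/2) * ennreal (\<eta>\<^sup>2 / (2 * c)) \<le> min_ubayes \<pi>"
    unfolding min_ubayes_def by (intro INF_greatest)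
  also have "\<dots> \<le> maximin p \<eta>"
    unfolding maximin_def by (rule SUP_upper[OF \<pi>])
  finally have le: "ennreal (1/2) * ennreal (\<eta>\<^sup>2 / (2 * c)) \<le> maximin p \<eta>" .
  have "0 < \<eta>\<^sup>2 / (2 * c)" using assms by (simp add: c_def)
  then have "0 < ennreal (1/2) * ennreal (\<eta>\<^sup>2 / (2 * c))"
    by (simp only: ennreal_zero_less_mult_iff ennreal_less_zero_iff) auto
  then show ?thesis using le by (rule less_le_trans)
qed

section \<open>Compactness of the set of admissible priors\<close>

lemma upriors_tail:
  assumes \<pi>: "\<pi> \<in> upriors p \<eta>" and "0 < p" "0 < \<eta>" "0 < \<epsilon>"
  shows "measure \<pi> {exp ((\<eta> powr p / \<epsilon>) powr (1 / p))<..} \<le> \<epsilon>"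
proof -
  interpret prob_space \<pi> using \<pi> by (simp add: upriors_def)
  have [measurable_cong]: "sets \<pi> = sets borel" using \<pi> by (simp add: upriors_def)
  \<comment> \<open>Markov's inequality for \<open>ln m powr p\<close>: the level \<open>?s\<close>
    solves \<open>?s powr p = ?B / \<epsilon>\<close>.\<close>
  let ?s = "(\<eta> powr p / \<epsilon>) powr (1 / p)" and ?B = "\<eta> powr p"
  have B: "0 < ?B" using assms by simp
  have s: "0 < ?s" "?s powr p = ?B / \<epsilon>" using assms B by (auto simp: powr_powr)
  have "ennreal (?B / \<epsilon>) * emeasure \<pi> {exp ?s<..} = (\<integral>\<^sup>+ m. ennreal (?B / \<epsilon>) * indicator {exp ?s<..} m \<partial>\<pi>)"
    by (rule nn_integral_cmult_indicator[symmetric]) simp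
  also have "\<dots> \<le> (\<integral>\<^sup>+ m. ennreal (ln m powr p) \<partial>\<pi>)"
  proof (rule nn_integral_mono)
    fix m
    have "?B / \<epsilon> \<le> ln m powr p" if "exp ?s < m"
    proof -
      have "0 < m" using that exp_gt_zero[of ?s] by linarith
      then have "?s \<le> ln m" using that by (simp add: ln_ge_iff)
      then have "?s powr p \<le> ln m powr p" using s assms by (intro powr_mono2) auto
      then show ?thesis using s by simp
    qed
    then show "ennreal (?B / \<epsilon>) * indicator {exp ?s<..} m \<le> ennreal (ln m powr p)"
      by (auto split: split_indicator intro!: ennreal_leI)
  qed
  also have "\<dots> \<le> ennreal ?B" using \<pi> by (simp add: upriors_def)
  finally have "?B / \<epsilon> * measure \<pi> {exp ?s<..} \<le> ?B"
    using B assms by (simp add: emeasure_eq_measure ennreal_mult[symmetric])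
  then show ?thesis using B assms by (simp add: field_simps)
qed

lemma tight_upriors:
  assumes \<pi>: "\<And>k. \<pi> k \<in> upriors p \<eta>" and "0 < p" "0 < \<eta>"
  shows "tight \<pi>"
  unfolding tight_def
proof (intro conjI allI impI)
  show "real_distribution (\<pi> k)" for k
    using \<pi>[of k] by (simp add: real_distribution_def real_distribution_axioms_def upriors_def)
  fix \<epsilon> :: real assume "0 < \<epsilon>"
  \<comment> \<open>Taking the tail bound at \<open>\<epsilon> / 2\<close> makes the inequality
    strict. On the left the endpoint 0 suffices, as the priors live on [1, \<infinity>).\<close>
  let ?b = "exp ((\<eta> powr p / (\<epsilon> / 2)) powr (1 / p))"
  have "1 - \<epsilon> < measure (\<pi> k) {0<..?b}" for k
  proof -
    interpret prob_space "\<pi> k" using \<pi>[of k] by (simp add: upriors_def)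
    have [measurable_cong]: "sets (\<pi> k) = sets borel" using \<pi>[of k] by (simp add: upriors_def)
    have sp: "space (\<pi> k) = UNIV" using sets_eq_imp_space_eq[of "\<pi> k" borel] \<pi>[of k] by (simp add: upriors_def)
    have ae: "AE m in \<pi> k. 1 \<le> m" using \<pi>[of k] by (simp add: upriors_def)
    have "prob {0<..?b} = prob (UNIV - {?b<..})"
      using ae by (intro finite_measure_eq_AE) (auto elim!: eventually_mono)
    also have "\<dots> = 1 - prob {?b<..}"
      using prob_compl[of "{?b<..}"] sp by simp
    also have "\<dots> \<ge> 1 - \<epsilon> / 2"
      using upriors_tail[OF \<pi>[of k] \<open>0 < p\<close> \<open>0 < \<eta>\<close>, of "\<epsilon> / 2"] \<open>0 < \<epsilon>\<close> by simp
    finally show ?thesis using \<open>0 < \<epsilon>\<close> by linarith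
  qed
  then show "\<exists>a b. a < b \<and> (\<forall>n. 1 - \<epsilon> < measure (\<pi> n) {a<..b})"
    by (intro exI[of _ 0] exI[of _ ?b]) auto
qed

text \<open>Bounded continuous test functions detect both constraints: the support through a
  function vanishing exactly on [1, \<infinity>), the moment through its truncations at level
  \<open>N\<close>, which Fatou's lemma then removes. The moment may drop in the limit but cannot
  exceed the budget.\<close>

lemma upriors_weak_limit:
  assumes \<pi>: "\<And>k. \<pi> k \<in> upriors p \<eta>" and "0 < p"
    and M: "real_distribution M" and wc: "weak_conv_m \<pi> M"
  shows "M \<in> upriors p \<eta>"
proof -
  interpret M: real_distribution M by fact
  have rd: "real_distribution (\<pi> k)" for k
    using \<pi>[of k] by (simp add: real_distribution_def real_distribution_axioms_def upriors_def)
  note conv = weak_conv_imp_integral_bdd_continuous_conv[OF rd M wc]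
  have ae: "AE m in \<pi> k. 1 \<le> m" for k using \<pi>[of k] by (simp add: upriors_def)
  have "AE m in M. 1 \<le> m"
  proof -
    let ?f = "\<lambda>m::real. max 0 (min 1 (1 - m))"
    have "(\<lambda>k. integral\<^sup>L (\<pi> k) ?f) \<longlonglongrightarrow> integral\<^sup>L M ?f"
      by (rule conv[where B=1]) (auto intro!: continuous_intros)
    moreover have "integral\<^sup>L (\<pi> k) ?f = 0" for k
      by (rule integral_eq_zero_AE) (use ae[of k] in \<open>auto elim!: eventually_mono\<close>)
    ultimately have "integral\<^sup>L M ?f = 0"
      using LIMSEQ_unique by (simp add: LIMSEQ_const_iff)
    moreover have "integrable M ?f"
      by (rule M.integrable_const_bound[where B=1]) auto
    ultimately have "AE m in M. ?f m = 0"
      by (subst (asm) integral_nonneg_eq_0_iff_AE) auto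
    then show ?thesis by eventually_elim (auto simp: max_def min_def split: if_splits)
  qed
  moreover have "(\<integral>\<^sup>+ m. ennreal (ln m powr p) \<partial>M) \<le> ennreal (\<eta> powr p)"
  proof -
    let ?f = "\<lambda>N m::real. min (real N) (ln (max 1 m) powr p)"
    have bnd: "(\<integral>\<^sup>+ m. ennreal (?f N m) \<partial>M) \<le> ennreal (\<eta> powr p)" for N
    proof -
      have int: "integrable \<rho> (?f N)" if "real_distribution \<rho>" for \<rho>
      proof -
        interpret R: real_distribution \<rho> by fact
        show ?thesis by (rule R.integrable_const_bound[where B="real N"]) auto
      qed
      have "continuous_on UNIV (?f N)"
        using \<open>0 < p\<close> by (intro continuous_intros continuous_on_powr') auto
      then have "isCont (?f N) x" for x
        by (simp add: continuous_on_eq_continuous_at)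
      then have "(\<lambda>k. integral\<^sup>L (\<pi> k) (?f N)) \<longlonglongrightarrow> integral\<^sup>L M (?f N)"
        by (rule conv[where B="real N"]) auto
      moreover have "integral\<^sup>L (\<pi> k) (?f N) \<le> \<eta> powr p" for k
      proof -
        have "ennreal (integral\<^sup>L (\<pi> k) (?f N)) = (\<integral>\<^sup>+ m. ennreal (?f N m) \<partial>\<pi> k)"
          by (rule nn_integral_eq_integral[symmetric, OF int[OF rd]]) auto
        also have "\<dots> \<le> (\<integral>\<^sup>+ m. ennreal (ln m powr p) \<partial>\<pi> k)"
          using ae[of k] by (intro nn_integral_mono_AE) (auto elim!: eventually_mono intro!: ennreal_leI simp: max_def)
        also have "\<dots> \<le> ennreal (\<eta> powr p)" using \<pi>[of k] by (simp add: upriors_def)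
        finally show ?thesis by simp
      qed
      ultimately have "integral\<^sup>L M (?f N) \<le> \<eta> powr p"
        by (intro LIMSEQ_le_const2) auto
      then show ?thesis
        by (subst nn_integral_eq_integral[OF int[OF M]]) (auto intro!: ennreal_leI)
    qed
    have "(\<integral>\<^sup>+ m. ennreal (ln m powr p) \<partial>M) = (\<integral>\<^sup>+ m. liminf (\<lambda>N. ennreal (?f N m)) \<partial>M)"
    proof (intro nn_integral_cong_AE, use \<open>AE m in M. 1 \<le> m\<close> in eventually_elim)
      case (elim m)
      have "\<forall>\<^sub>F N in sequentially. ln m powr p \<le> real N"
        by (rule eventually_sequentiallyI[of "nat \<lceil>ln m powr p\<rceil>"]) linarith
      then have "\<forall>\<^sub>F N in sequentially. ennreal (?f N m) = ennreal (ln m powr p)"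
        by eventually_elim (use elim in \<open>auto simp: max_def min_def\<close>)
      then have "(\<lambda>N. ennreal (?f N m)) \<longlonglongrightarrow> ennreal (ln m powr p)"
        by (rule tendsto_eventually)
      then show ?case by (intro lim_imp_Liminf[symmetric]) auto
    qed
    also have "\<dots> \<le> liminf (\<lambda>N. \<integral>\<^sup>+ m. ennreal (?f N m) \<partial>M)"
      by (rule nn_integral_liminf) auto
    also have "\<dots> \<le> ennreal (\<eta> powr p)"
      using bnd by (intro order_trans[OF Liminf_le_Limsup] Limsup_bounded) auto
    finally show ?thesis .
  qed
  ultimately show ?thesis
    by (simp add: upriors_def M.prob_space_axioms)
qed

lemma ubayes_ln_close_eq_integral:
  assumes \<pi>: "nprior \<pi>" and d: "ln_close A d"
  shows "ubayes d \<pi> = ennreal (LINT m|\<pi>. enn2real (urisk d (max 1 m)))"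
proof -
  interpret prob_space \<pi> using \<pi> by (simp add: nprior_def)
  have [measurable_cong]: "sets \<pi> = sets borel" using \<pi> by (simp add: nprior_def)
  have [measurable]: "d \<in> borel_measurable borel" using d by (simp add: ln_close_def)
  have fin: "urisk d (max 1 m) \<le> ennreal (close_bound A)" for m
    by (rule urisk_ln_close_le[OF d]) (simp add: less_max_iff_disj)
  have "ubayes d \<pi> = (\<integral>\<^sup>+ m. ennreal (enn2real (urisk d (max 1 m))) \<partial>\<pi>)"
    unfolding ubayes_def
  proof (rule nn_integral_cong_AE)
    have "AE m in \<pi>. 1 \<le> m" using \<pi> by (simp add: nprior_def)
    then show "AE m in \<pi>. urisk d m = ennreal (enn2real (urisk d (max 1 m)))"
    proof eventually_elim
      case (elim m)
      have "urisk d m < top" using fin[of m] elim by (simp add: max_def le_less_trans[OF _ ennreal_less_top])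
      then show ?case using elim by (simp add: max_def)
    qed
  qed
  also have "\<dots> = ennreal (LINT m|\<pi>. enn2real (urisk d (max 1 m)))"
  proof (rule nn_integral_eq_integral)
    show "integrable \<pi> (\<lambda>m. enn2real (urisk d (max 1 m)))"
      by (rule integrable_const_bound[where B="enn2real (ennreal (close_bound A))"])
         (auto intro!: enn2real_mono fin)
  qed auto
  finally show ?thesis .
qed

text \<open>An infimum of weakly continuous functionals is upper semicontinuous, so a weak limit of
  a maximising sequence is a maximiser. Continuity is available for clamped rules; passing from a
  rule to its clamped version costs \<open>ln_tail\<close>, which vanishes as the level
  grows.\<close>

theorem least_favourable_exists:
  assumes "0 < p" "0 < \<eta>"
  obtains \<pi> where "\<pi> \<in> upriors p \<eta>" "maximin p \<eta> \<le> min_ubayes \<pi>"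
proof -
  have ne: "min_ubayes ` upriors p \<eta> \<noteq> {}"
    using upriors_return[of 1 p \<eta>] by (auto simp: powr_ge_zero)
  obtain v where v: "incseq v" "range v \<subseteq> min_ubayes ` upriors p \<eta>" "Sup (min_ubayes ` upriors p \<eta>) = (SUP k. v k)"
    using ennreal_Sup_countable_SUP[OF ne] by blast
  have "\<forall>k. \<exists>\<pi>. \<pi> \<in> upriors p \<eta> \<and> v k = min_ubayes \<pi>"
    using v(2) by (auto simp: image_iff subset_eq)
  then obtain \<rho> where \<rho>: "\<And>k. \<rho> k \<in> upriors p \<eta>" "\<And>k. v k = min_ubayes (\<rho> k)"
    by metis
  have v_lim: "v \<longlonglongrightarrow> maximin p \<eta>"
    unfolding maximin_def v(3) using v(1) by (rule LIMSEQ_SUP)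
  \<comment> \<open>The selection theorem thins out a given subsequence; \<open>id\<close> makes
    that the whole sequence.\<close>
  obtain r M where r: "strict_mono r" and M: "real_distribution M" and wc: "weak_conv_m (\<rho> \<circ> id \<circ> r) M"
    using tight_imp_convergent_subsubsequence[OF tight_upriors[where \<pi>=\<rho>, OF \<rho>(1) assms] strict_mono_id]
    by blast
  define \<pi> where "\<pi> = \<rho> \<circ> r"
  have \<pi>: "\<pi> k \<in> upriors p \<eta>" for k by (simp add: \<pi>_def \<rho>)
  have wc: "weak_conv_m \<pi> M" using wc by (simp add: \<pi>_def)
  have lim: "(\<lambda>k. min_ubayes (\<pi> k)) \<longlonglongrightarrow> maximin p \<eta>"
    using LIMSEQ_subseq_LIMSEQ[OF v_lim r] by (simp add: \<pi>_def \<rho> comp_def)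
  have Mp: "M \<in> upriors p \<eta>"
    by (rule upriors_weak_limit[OF \<pi> assms(1) M wc])
  have rd: "real_distribution (\<pi> k)" for k
    using \<pi>[of k] by (simp add: real_distribution_def real_distribution_axioms_def upriors_def)
  have "maximin p \<eta> \<le> min_ubayes M"
    unfolding min_ubayes_def
  proof (rule INF_greatest)
    fix d :: "real \<Rightarrow> real" assume d [measurable]: "d \<in> borel_measurable borel"
    have "maximin p \<eta> \<le> ubayes d M + ln_tail (real j)" for j
    proof -
      let ?d = "clampd (real j) d"
      have cl: "ln_close (real j) ?d" by (rule ln_close_clampd[OF d]) simp
      then have [measurable]: "?d \<in> borel_measurable borel" by (simp add: ln_close_def)
      have "(\<lambda>k. LINT m|\<pi> k. enn2real (urisk ?d (max 1 m))) \<longlonglongrightarrow> (LINT m|M. enn2real (urisk ?d (max 1 m)))"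
        by (rule weak_conv_imp_integral_bdd_continuous_conv[OF rd M wc, where B="enn2real (ennreal (close_bound (real j)))"])
           (auto intro!: isCont_urisk_ln_close[OF cl] enn2real_mono urisk_ln_close_le[OF cl] simp: less_max_iff_disj)
      then have "(\<lambda>k. ubayes ?d (\<pi> k)) \<longlonglongrightarrow> ubayes ?d M"
        unfolding ubayes_ln_close_eq_integral[OF upriors_nprior[OF \<pi>] cl]
          ubayes_ln_close_eq_integral[OF upriors_nprior[OF Mp] cl] by (rule tendsto_ennrealI)
      then have "maximin p \<eta> \<le> ubayes ?d M"
        by (rule LIMSEQ_le[OF lim]) (auto simp: min_ubayes_def intro!: INF_lower)
      also have "\<dots> \<le> ubayes d M + ln_tail (real j)"
        by (rule ubayes_clampd_le[OF upriors_nprior[OF Mp] _ d]) simp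
      finally show ?thesis .
    qed
    moreover have "(\<lambda>j. ubayes d M + ln_tail (real j)) \<longlonglongrightarrow> ubayes d M + 0"
      by (intro tendsto_add tendsto_const ln_tail_tendsto)
    ultimately show "maximin p \<eta> \<le> ubayes d M"
      by (intro LIMSEQ_le_const[of _ "ubayes d M"]) auto
  qed
  with Mp show ?thesis by (rule that)
qed

subsection \<open>Reduction of the minimax-Bayes risk to one dimension\<close>

text \<open>
  Writing the observations as \<open>\<mu>\<^sub>i e\<^sub>i\<close> with standard exponential \<open>e\<^sub>i\<close> makes the sampling measure
  independent of the parameter, so that Fubini applies to parameter and noise jointly.
\<close>

definition scale :: "nat \<Rightarrow> (nat \<Rightarrow> real) \<Rightarrow> (nat \<Rightarrow> real) \<Rightarrow> (nat \<Rightarrow> real)" where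
  "scale n \<mu> e = (\<lambda>i\<in>{..<n}. \<mu> i * e i)"

abbreviation RV :: "nat \<Rightarrow> (nat \<Rightarrow> real) measure" where
  "RV n \<equiv> PiM {..<n} (\<lambda>_. borel)"

abbreviation std_expo :: "nat \<Rightarrow> (nat \<Rightarrow> real) measure" where
  "std_expo n \<equiv> PiM {..<n} (\<lambda>_. expo 1)"

lemma sets_PiM_expo [measurable_cong]: "sets (PiM I (\<lambda>i. expo (\<mu> i))) = sets (PiM I (\<lambda>_. borel))"
  by (rule sets_PiM_cong) auto

lemma space_PiM_expo: "space (PiM I (\<lambda>i. expo (\<mu> i))) = space (PiM I (\<lambda>_. borel))"
  by (rule sets_eq_imp_space_eq[OF sets_PiM_expo])

lemma obs_model_eq_PiM: "obs_model n \<mu> = PiM {..<n} (\<lambda>i. expo (\<mu> i))"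
  by (simp add: obs_model_def expo_def)

lemma sets_obs_model [measurable_cong]: "sets (obs_model n \<mu>) = sets (RV n)"
  by (simp add: obs_model_eq_PiM sets_PiM_expo)

lemma prob_space_std_expo: "prob_space (PiM I (\<lambda>_. expo 1))"
  by (rule prob_space_PiM) (simp add: prob_space_expo)

lemma measurable_scale [measurable]:
  assumes [measurable]: "f \<in> measurable M (RV n)" "g \<in> measurable M (RV n)"
  shows "(\<lambda>z. scale n (f z) (g z)) \<in> measurable M (RV n)"
  unfolding scale_def
proof (rule measurable_restrict)
  fix i assume i: "i \<in> {..<n}"
  have "(\<lambda>z. f z i) \<in> borel_measurable M" "(\<lambda>z. g z i) \<in> borel_measurable M"
    using measurable_compose[OF assms(1) measurable_component_singleton[OF i]]
      measurable_compose[OF assms(2) measurable_component_singleton[OF i]] by auto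
  then show "(\<lambda>z. f z i * g z i) \<in> borel_measurable M" by measurable
qed

lemma obs_model_eq_distr:
  assumes "\<And>i. i < n \<Longrightarrow> 0 < \<mu> i"
  shows "obs_model n \<mu> = distr (std_expo n) (RV n) (scale n \<mu>)"
proof -
  \<comment> \<open>Beyond coordinate n the parameter may fail to be positive, while
    \<open>product_prob_space\<close> wants a probability measure at every index; 1 serves as
    default.\<close>
  define \<nu> where "\<nu> i = (if i < n then \<mu> i else 1)" for i
  have \<nu>: "0 < \<nu> i" for i using assms by (simp add: \<nu>_def)
  interpret E: product_prob_space "\<lambda>_::nat. expo 1"
    by (rule product_prob_spaceI) (simp add: prob_space_expo)
  interpret N: product_prob_space "\<lambda>i. expo (\<nu> i)"
    by (rule product_prob_spaceI) (simp add: prob_space_expo \<nu>)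
  have s_eq: "scale n \<mu> = scale n \<nu>"
    by (auto simp: scale_def \<nu>_def fun_eq_iff)
  have sm: "scale n \<nu> \<in> measurable (std_expo n) (RV n)"
    unfolding scale_def
    by (rule measurable_restrict) (auto intro!: borel_measurable_times measurable_component_singleton cong: measurable_cong_sets)
  have "distr (std_expo n) (RV n) (scale n \<nu>) = PiM {..<n} (\<lambda>i. expo (\<nu> i))"
  proof (rule N.PiM_eqI)
    fix A :: "nat \<Rightarrow> real set" assume "\<And>i. i \<in> {..<n} \<Longrightarrow> A i \<in> sets (expo (\<nu> i))"
    then have A: "A i \<in> sets borel" if "i < n" for i using that by simp
    have vim: "scale n \<nu> -` (Pi\<^sub>E {..<n} A) \<inter> space (std_expo n) = (\<Pi>\<^sub>E i\<in>{..<n}. (\<lambda>e. \<nu> i * e) -` A i)"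
      by (auto simp: scale_def space_PiM PiE_iff)
    have Am: "(\<lambda>e. \<nu> i * e) -` A i \<in> sets borel" if "i < n" for i
      using measurable_sets[of "\<lambda>e. \<nu> i * e" borel borel "A i"] A[OF that] by simp
    have "emeasure (distr (std_expo n) (RV n) (scale n \<nu>)) (Pi\<^sub>E {..<n} A) =
        emeasure (std_expo n) (\<Pi>\<^sub>E i\<in>{..<n}. (\<lambda>e. \<nu> i * e) -` A i)"
      unfolding vim[symmetric] using A by (intro emeasure_distr sm) (auto intro!: sets_PiM_I_finite)
    also have "\<dots> = (\<Prod>i\<in>{..<n}. emeasure (expo 1) ((\<lambda>e. \<nu> i * e) -` A i))"
      using Am by (intro E.emeasure_PiM) auto
    also have "\<dots> = (\<Prod>i\<in>{..<n}. emeasure (expo (\<nu> i)) (A i))"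
      using A by (intro prod.cong refl) (simp add: expo_eq_distr[OF \<nu>] emeasure_distr)
    finally show "emeasure (distr (std_expo n) (RV n) (scale n \<nu>)) (Pi\<^sub>E {..<n} A) =
        (\<Prod>i\<in>{..<n}. emeasure (expo (\<nu> i)) (A i))" .
  qed (auto simp: sets_PiM_expo)
  also have "PiM {..<n} (\<lambda>i. expo (\<nu> i)) = obs_model n \<mu>"
    unfolding obs_model_eq_PiM by (rule PiM_cong) (auto simp: \<nu>_def)
  finally show ?thesis by (simp add: s_eq)
qed

lemma estimators_iff:
  "est \<in> estimators n \<longleftrightarrow> (\<forall>i<n. (\<lambda>x. est x i) \<in> borel_measurable (RV n)) \<and> (\<forall>x. \<forall>i<n. 0 < est x i)"
proof -
  have "sets (PiM {..<n} (\<lambda>_. lborel :: real measure)) = sets (RV n)"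
    by (rule sets_PiM_cong) auto
  then have "borel_measurable (PiM {..<n} (\<lambda>_. lborel :: real measure)) = (borel_measurable (RV n) :: ((nat \<Rightarrow> real) \<Rightarrow> real) set)"
    by (rule measurable_cong_sets) simp
  then show ?thesis by (simp add: estimators_def)
qed

lemma measurable_log_loss:
  assumes est: "est \<in> estimators n"
    and x [measurable]: "x \<in> measurable M (RV n)" and \<mu>: "\<And>i. i < n \<Longrightarrow> (\<lambda>z. \<mu> z i) \<in> borel_measurable M"
  shows "(\<lambda>z. log_loss n (est (x z)) (\<mu> z)) \<in> borel_measurable M"
proof -
  have "(\<lambda>z. est (x z) i) \<in> borel_measurable M" if "i < n" for i
    by (rule measurable_compose[OF x, of "\<lambda>x. est x i"]) (use est that in \<open>auto simp: estimators_iff\<close>)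
  then show ?thesis
    unfolding log_loss_def
    by (intro borel_measurable_times borel_measurable_const borel_measurable_sum borel_measurable_power
        borel_measurable_diff borel_measurable_ln \<mu>) auto
qed

lemma risk_eq_scaled:
  assumes "est \<in> estimators n" "\<And>i. i < n \<Longrightarrow> 0 < \<mu> i"
  shows "risk n est \<mu> = (\<integral>\<^sup>+ e. ennreal (log_loss n (est (scale n \<mu> e)) \<mu>) \<partial>std_expo n)"
proof -
  have sm: "scale n \<mu> \<in> measurable (std_expo n) (RV n)"
    unfolding scale_def
    by (rule measurable_restrict) (auto intro!: borel_measurable_times measurable_component_singleton cong: measurable_cong_sets)
  have lm: "(\<lambda>x. log_loss n (est x) \<mu>) \<in> borel_measurable (RV n)"
    by (rule measurable_log_loss[OF assms(1), where x="\<lambda>x. x" and \<mu>="\<lambda>_. \<mu>"]) auto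
  have eq: "obs_model n \<mu> = distr (std_expo n) (RV n) (scale n \<mu>)"
    by (rule obs_model_eq_distr[OF assms(2)])
  show ?thesis
    unfolding risk_def eq
    by (rule nn_integral_distr[OF sm]) (simp add: measurable_compose[OF lm measurable_ennreal])
qed

text \<open>
  Agrees with \<open>risk\<close> for positive parameters, and is measurable without a restriction on them.
\<close>

definition scaled_risk :: "nat \<Rightarrow> ((nat \<Rightarrow> real) \<Rightarrow> (nat \<Rightarrow> real)) \<Rightarrow> (nat \<Rightarrow> real) \<Rightarrow> ennreal" where
  "scaled_risk n est \<mu> = (\<integral>\<^sup>+ e. ennreal (log_loss n (est (scale n \<mu> e)) \<mu>) \<partial>std_expo n)"

lemma measurable_scaled_risk:
  assumes "est \<in> estimators n"
  shows "scaled_risk n est \<in> borel_measurable (RV n)"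
proof -
  interpret prob_space "std_expo n" by (rule prob_space_std_expo)
  have "(\<lambda>z. log_loss n (est (scale n (fst z) (snd z))) (fst z)) \<in> borel_measurable (RV n \<Otimes>\<^sub>M std_expo n)"
  proof (rule measurable_log_loss[OF assms])
    show "(\<lambda>z. scale n (fst z) (snd z)) \<in> measurable (RV n \<Otimes>\<^sub>M std_expo n) (RV n)"
      by measurable
    show "(\<lambda>z. fst z i) \<in> borel_measurable (RV n \<Otimes>\<^sub>M std_expo n)" if "i < n" for i
      using that by (intro measurable_compose[OF measurable_fst measurable_component_singleton]) simp
  qed
  then show ?thesis
    unfolding scaled_risk_def[abs_def]
    by (intro borel_measurable_nn_integral) (simp add: case_prod_beta')
qed

section \<open>Point masses as priors\<close>

lemma risk_cong:
  assumes "\<And>i. i < n \<Longrightarrow> \<mu> i = \<nu> i"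
  shows "risk n est \<mu> = risk n est \<nu>"
proof -
  have "obs_model n \<mu> = obs_model n \<nu>"
    unfolding obs_model_eq_PiM by (rule PiM_cong) (auto simp: assms)
  moreover have "log_loss n a \<mu> = log_loss n a \<nu>" for a
    unfolding log_loss_def by (simp add: assms)
  ultimately show ?thesis by (simp add: risk_def)
qed

text \<open>The point mass at a member of \<open>Mset\<close> obeys the moment constraint, so for
  each estimator the supremum over priors dominates the supremum over parameters.\<close>

lemma minimax_risk_le_minimax_bayes_risk:
  "minimax_risk n p \<eta> \<le> minimax_bayes_risk n p \<eta>"
  unfolding minimax_risk_def minimax_bayes_risk_def
proof (rule INF_mono)
  fix est assume est: "est \<in> estimators n"
  have "(SUP \<mu>\<in>Mset n p \<eta>. risk n est \<mu>) \<le> (SUP \<pi>\<in>priors n p \<eta>. bayes_risk n est \<pi>)"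
  proof (rule SUP_least)
    fix \<mu> assume \<mu>: "\<mu> \<in> Mset n p \<eta>"
    \<comment> \<open>Members of \<open>Mset\<close> are arbitrary beyond coordinate n, whereas
      points of the product space are \<open>undefined\<close> there; \<open>risk_cong\<close> later
      undoes the restriction.\<close>
    define \<nu> where "\<nu> = restrict \<mu> {..<n}"
    define \<pi> where "\<pi> = return (RV n) \<nu>"
    have sp: "\<nu> \<in> space (RV n)" by (simp add: \<nu>_def space_PiM)
    have cm: "(\<lambda>\<mu>. \<mu> i) \<in> borel_measurable (RV n)" if "i < n" for i
      using that by (intro measurable_component_singleton) simp
    have pm: "(\<lambda>\<mu>. ln (\<mu> i) powr p) \<in> borel_measurable (RV n)" if "i < n" for i
      using cm[OF that] by measurable
    have "Measurable.pred (RV n) (\<lambda>\<mu>. 1 \<le> \<mu> i)" if "i < n" for i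
      using cm[OF that] by measurable
    then have "Measurable.pred (RV n) (\<lambda>\<mu>. \<forall>i\<in>{..<n}. 1 \<le> \<mu> i)"
      by (intro pred_intros_finite) auto
    then have pr: "Measurable.pred (RV n) (\<lambda>\<mu>. \<forall>i<n. 1 \<le> \<mu> i)" by simp
    have ae: "AE \<mu> in \<pi>. \<forall>i<n. 1 \<le> \<mu> i"
      unfolding \<pi>_def by (subst AE_return[OF sp pr]) (use \<mu> in \<open>auto simp: \<nu>_def Mset_def\<close>)
    have "\<pi> \<in> priors n p \<eta>"
      unfolding priors_def
    proof (safe intro!: ae)
      show "prob_space \<pi>" unfolding \<pi>_def by (rule prob_space_return[OF sp])
      have "(\<integral>\<^sup>+ \<mu>. ennreal ((1 / real n) * (\<Sum>i<n. ln (\<mu> i) powr p)) \<partial>\<pi>) =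
          ennreal ((1 / real n) * (\<Sum>i<n. ln (\<nu> i) powr p))"
        unfolding \<pi>_def
      proof (rule nn_integral_return[OF sp], rule measurable_compose[OF _ measurable_ennreal])
        show "(\<lambda>\<mu>. (1 / real n) * (\<Sum>i<n. ln (\<mu> i) powr p)) \<in> borel_measurable (RV n)"
          by (intro borel_measurable_times borel_measurable_const borel_measurable_sum pm) simp
      qed
      also have "\<dots> \<le> ennreal (\<eta> powr p)"
        using \<mu> by (intro ennreal_leI) (simp add: Mset_def \<nu>_def)
      finally show "(\<integral>\<^sup>+ \<mu>. ennreal ((1 / real n) * (\<Sum>i<n. ln (\<mu> i) powr p)) \<partial>\<pi>) \<le> ennreal (\<eta> powr p)" .
    qed (simp_all add: \<pi>_def)
    moreover have "bayes_risk n est \<pi> = risk n est \<mu>"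
    proof -
      \<comment> \<open>Evaluation under \<open>return\<close> asks for measurability on the whole
        space, which \<open>scaled_risk\<close> provides.\<close>
      have "bayes_risk n est \<pi> = (\<integral>\<^sup>+ \<mu>. scaled_risk n est \<mu> \<partial>\<pi>)"
        unfolding bayes_risk_def scaled_risk_def
        using ae by (intro nn_integral_cong_AE) (auto elim!: eventually_mono intro!: risk_eq_scaled[OF est] intro: less_le_trans[OF zero_less_one])
      also have "\<dots> = scaled_risk n est \<nu>"
        unfolding \<pi>_def by (rule nn_integral_return[OF sp measurable_scaled_risk[OF est]])
      also have "\<dots> = risk n est \<nu>"
        unfolding scaled_risk_def
        by (rule risk_eq_scaled[OF est, symmetric]) (use \<mu> in \<open>auto simp: \<nu>_def Mset_def intro: less_le_trans[OF zero_less_one]\<close>)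
      also have "\<dots> = risk n est \<mu>" by (rule risk_cong) (simp add: \<nu>_def)
      finally show ?thesis .
    qed
    ultimately show "risk n est \<mu> \<le> (SUP \<pi>\<in>priors n p \<eta>. bayes_risk n est \<pi>)"
      by (metis SUP_upper)
  qed
  then show "\<exists>est'\<in>estimators n. (SUP \<mu>\<in>Mset n p \<eta>. risk n est' \<mu>) \<le> (SUP \<pi>\<in>priors n p \<eta>. bayes_risk n est \<pi>)"
    using est by blast
qed

section \<open>Separable rules and averaged marginals\<close>

lemma ennreal_mean:
  assumes "0 < n" "\<And>i. i < n \<Longrightarrow> 0 \<le> a i"
  shows "ennreal ((1 / real n) * (\<Sum>i<n. a i)) = (\<Sum>i<n. ennreal (a i)) / ennreal (real n)"
proof -
  have "(\<Sum>i<n. ennreal (a i)) = ennreal (\<Sum>i<n. a i)"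
    by (rule sum_ennreal) (use assms in auto)
  moreover have "ennreal (\<Sum>i<n. a i) / ennreal (real n) = ennreal ((\<Sum>i<n. a i) / real n)"
    by (rule divide_ennreal) (use assms in \<open>auto intro!: sum_nonneg\<close>)
  ultimately show ?thesis by simp
qed

lemma nn_integral_mean:
  assumes "0 < n" "\<And>i x. i < n \<Longrightarrow> 0 \<le> a i x" and m: "\<And>i. i < n \<Longrightarrow> a i \<in> borel_measurable M"
  shows "(\<integral>\<^sup>+ x. ennreal ((1 / real n) * (\<Sum>i<n. a i x)) \<partial>M) = (\<Sum>i<n. \<integral>\<^sup>+ x. ennreal (a i x) \<partial>M) / ennreal (real n)"
proof -
  have "(\<integral>\<^sup>+ x. ennreal ((1 / real n) * (\<Sum>i<n. a i x)) \<partial>M) = (\<integral>\<^sup>+ x. (\<Sum>i<n. ennreal (a i x)) / ennreal (real n) \<partial>M)"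
    by (intro nn_integral_cong ennreal_mean assms)
  also have "\<dots> = (\<integral>\<^sup>+ x. (\<Sum>i<n. ennreal (a i x)) \<partial>M) / ennreal (real n)"
    using m by (intro nn_integral_divide borel_measurable_sum) auto
  also have "(\<integral>\<^sup>+ x. (\<Sum>i<n. ennreal (a i x)) \<partial>M) = (\<Sum>i<n. \<integral>\<^sup>+ x. ennreal (a i x) \<partial>M)"
    using m by (intro nn_integral_sum) auto
  finally show ?thesis .
qed

lemma nn_integral_PiM_component:
  assumes "\<And>i. i \<in> I \<Longrightarrow> prob_space (M i)" "i \<in> I" "f \<in> borel_measurable (M i)"
  shows "(\<integral>\<^sup>+ x. f (x i) \<partial>PiM I M) = (\<integral>\<^sup>+ y. f y \<partial>M i)"
proof -
  have "(\<integral>\<^sup>+ y. f y \<partial>M i) = (\<integral>\<^sup>+ y. f y \<partial>distr (PiM I M) (M i) (\<lambda>x. x i))"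
    using assms by (simp add: distr_PiM_component)
  also have "\<dots> = (\<integral>\<^sup>+ x. f (x i) \<partial>PiM I M)"
    using assms by (intro nn_integral_distr measurable_component_singleton) auto
  finally show ?thesis ..
qed

lemma risk_separable:
  assumes "0 < n" and [measurable]: "d \<in> borel_measurable borel" and \<mu>: "\<And>i. i < n \<Longrightarrow> 0 < \<mu> i"
  shows "risk n (\<lambda>x i. exp (d (x i))) \<mu> = (\<Sum>i<n. urisk d (\<mu> i)) / ennreal (real n)"
proof -
  have m: "(\<lambda>x. (d (x i) - ln (\<mu> i))\<^sup>2) \<in> borel_measurable (obs_model n \<mu>)" if "i < n" for i
  proof -
    have "(\<lambda>x. x i) \<in> measurable (RV n) borel" using that by (intro measurable_component_singleton) simp
    then have [measurable]: "(\<lambda>x. x i) \<in> borel_measurable (obs_model n \<mu>)" by (simp add: sets_obs_model cong: measurable_cong_sets)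
    show ?thesis by measurable
  qed
  have "risk n (\<lambda>x i. exp (d (x i))) \<mu> = (\<integral>\<^sup>+ x. ennreal ((1 / real n) * (\<Sum>i<n. (d (x i) - ln (\<mu> i))\<^sup>2)) \<partial>obs_model n \<mu>)"
    by (simp add: risk_def log_loss_def)
  also have "\<dots> = (\<Sum>i<n. \<integral>\<^sup>+ x. ennreal ((d (x i) - ln (\<mu> i))\<^sup>2) \<partial>obs_model n \<mu>) / ennreal (real n)"
    by (rule nn_integral_mean) (use assms m in auto)
  also have "(\<Sum>i<n. \<integral>\<^sup>+ x. ennreal ((d (x i) - ln (\<mu> i))\<^sup>2) \<partial>obs_model n \<mu>) = (\<Sum>i<n. urisk d (\<mu> i))"
    unfolding obs_model_eq_PiM urisk_def
    by (intro sum.cong refl nn_integral_PiM_component[where M="\<lambda>i. expo (\<mu> i)" and f="\<lambda>y. ennreal ((d y - ln (\<mu> _))\<^sup>2)"])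
       (auto simp: \<mu> prob_space_expo)
  finally show ?thesis .
qed

text \<open>For a coordinatewise rule both risk and constraint are averages over coordinates. They
  see \<open>\<pi>\<close> only through the uniform mixture \<open>?\<rho>\<close> of its marginals,
  whatever the dependence between coordinates, and \<open>?\<rho>\<close> is admissible in one
  dimension with the same budget.\<close>

lemma bayes_risk_separable_le:
  assumes "0 < n" and [measurable]: "d \<in> borel_measurable borel"
    and b: "\<And>\<pi>. \<pi> \<in> upriors p \<eta> \<Longrightarrow> ubayes d \<pi> \<le> b" and \<pi>: "\<pi> \<in> priors n p \<eta>"
  shows "bayes_risk n (\<lambda>x i. exp (d (x i))) \<pi> \<le> b"
proof -
  interpret prob_space \<pi> using \<pi> by (simp add: priors_def)
  have sets: "sets \<pi> = sets (RV n)" using \<pi> by (simp add: priors_def)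
  have ae: "AE \<mu> in \<pi>. \<forall>i<n. 1 \<le> \<mu> i" using \<pi> by (simp add: priors_def)
  have cm [measurable]: "(\<lambda>\<mu>. \<mu> i) \<in> borel_measurable \<pi>" if "i < n" for i
  proof -
    have "(\<lambda>\<mu>. \<mu> i) \<in> borel_measurable (RV n)"
      using that by (intro measurable_component_singleton) simp
    then show ?thesis by (simp add: sets cong: measurable_cong_sets)
  qed
  \<comment> \<open>\<open>mixture\<close> wants a probability measure on [1, \<infinity>) at every
    index. Indices from n on get the point mass at 1; their weight in
    \<open>pmf_of_set {..<n}\<close> is 0.\<close>
  define f where "f i = (if i < n then distr \<pi> borel (\<lambda>\<mu>. \<mu> i) else return borel 1)" for i
  have f: "prob_space (f i)" "sets (f i) = sets borel" for i
    unfolding f_def by (auto intro!: prob_space_distr cm prob_space_return)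
  have f_ae: "AE m in f i. 1 \<le> m" for i
    unfolding f_def using ae by (auto simp: AE_distr_iff cm AE_return elim!: eventually_mono)
  let ?\<rho> = "mixture (pmf_of_set {..<n}) f"
  have ne: "{..<n} \<noteq> {}" using assms by auto
  have mix: "(\<integral>\<^sup>+ m. g m \<partial>?\<rho>) = (\<Sum>i<n. \<integral>\<^sup>+ \<mu>. g (\<mu> i) \<partial>\<pi>) / ennreal (real n)"
    if [measurable]: "g \<in> borel_measurable borel" for g
  proof -
    have "(\<integral>\<^sup>+ m. g m \<partial>?\<rho>) = (\<Sum>i<n. \<integral>\<^sup>+ m. g m \<partial>f i) / ennreal (real n)"
      using ne by (simp add: nn_integral_mixture[OF f] nn_integral_pmf_of_set ennreal_of_nat_eq_real_of_nat)
    also have "(\<Sum>i<n. \<integral>\<^sup>+ m. g m \<partial>f i) = (\<Sum>i<n. \<integral>\<^sup>+ \<mu>. g (\<mu> i) \<partial>\<pi>)"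
      by (intro sum.cong refl) (auto simp: f_def nn_integral_distr cm)
    finally show ?thesis .
  qed
  have "?\<rho> \<in> upriors p \<eta>"
  proof -
    have "(\<integral>\<^sup>+ m. ennreal (ln m powr p) \<partial>?\<rho>) = (\<integral>\<^sup>+ \<mu>. ennreal ((1 / real n) * (\<Sum>i<n. ln (\<mu> i) powr p)) \<partial>\<pi>)"
      by (subst mix, simp, subst nn_integral_mean) (auto simp: assms)
    also have "\<dots> \<le> ennreal (\<eta> powr p)" using \<pi> by (simp add: priors_def)
    finally show ?thesis
      unfolding upriors_def
      using prob_space_mixture[where f=f, OF f] sets_mixture[where f=f, OF f]
        AE_mixture[where f=f, OF f _ f_ae] by simp
  qed
  then have "ubayes d ?\<rho> \<le> b" by (rule b)
  moreover have "ubayes d ?\<rho> = bayes_risk n (\<lambda>x i. exp (d (x i))) \<pi>"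
  proof -
    have "ubayes d ?\<rho> = (\<Sum>i<n. \<integral>\<^sup>+ \<mu>. urisk d (\<mu> i) \<partial>\<pi>) / ennreal (real n)"
      unfolding ubayes_def by (rule mix) simp
    also have "\<dots> = (\<integral>\<^sup>+ \<mu>. (\<Sum>i<n. urisk d (\<mu> i)) \<partial>\<pi>) / ennreal (real n)"
      by (subst nn_integral_sum) auto
    also have "\<dots> = (\<integral>\<^sup>+ \<mu>. (\<Sum>i<n. urisk d (\<mu> i)) / ennreal (real n) \<partial>\<pi>)"
      by (rule nn_integral_divide[symmetric]) auto
    also have "\<dots> = bayes_risk n (\<lambda>x i. exp (d (x i))) \<pi>"
      unfolding bayes_risk_def
    proof (rule nn_integral_cong_AE, use ae in eventually_elim)
      case (elim \<mu>)
      then show ?case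
        by (intro risk_separable[symmetric]) (use assms in \<open>auto intro: less_le_trans[OF zero_less_one]\<close>)
    qed
    finally show ?thesis .
  qed
  ultimately show ?thesis by simp
qed

theorem minimax_bayes_risk_le:
  assumes "0 < n" "0 < p" "0 < \<eta>"
  shows "minimax_bayes_risk n p \<eta> \<le> maximin p \<eta>"
proof -
  obtain \<pi> where \<pi>: "\<pi> \<in> upriors p \<eta>" "maximin p \<eta> \<le> min_ubayes \<pi>"
    using least_favourable_exists[OF assms(2,3)] by blast
  let ?d = "post_mean \<pi>"
  have dm [measurable]: "?d \<in> borel_measurable borel"
    by (rule measurable_post_mean[OF upriors_nprior[OF \<pi>(1)]])
  have "(\<lambda>x. exp (?d (x i))) \<in> borel_measurable (RV n)" if "i < n" for i
  proof -
    have [measurable]: "(\<lambda>x. x i) \<in> borel_measurable (RV n)"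
      using that by (intro measurable_component_singleton) simp
    show ?thesis by measurable
  qed
  then have "(\<lambda>x i. exp (?d (x i))) \<in> estimators n"
    unfolding estimators_iff by simp
  then have "minimax_bayes_risk n p \<eta> \<le> (SUP \<rho>\<in>priors n p \<eta>. bayes_risk n (\<lambda>x i. exp (?d (x i))) \<rho>)"
    unfolding minimax_bayes_risk_def by (rule INF_lower)
  also have "\<dots> \<le> maximin p \<eta>"
    by (intro SUP_least bayes_risk_separable_le assms dm least_favourable_minimax[OF \<pi> maximin_finite])
  finally show ?thesis .
qed

subsection \<open>Product priors\<close>

lemma sets_PiM_eq_borel:
  "sets \<pi> = sets borel \<Longrightarrow> sets (PiM I (\<lambda>_. \<pi>)) = sets (PiM I (\<lambda>_. borel))"
  by (rule sets_PiM_cong) auto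

lemma coordinate_bayes_ge:
  assumes \<pi>: "nprior \<pi>" and g: "g \<in> borel_measurable (RV n)" and i: "i < n"
  shows "min_ubayes \<pi> \<le>
    (\<integral>\<^sup>+ \<mu>. \<integral>\<^sup>+ e. ennreal ((g (scale n \<mu> e) - ln (\<mu> i))\<^sup>2) \<partial>std_expo n \<partial>PiM {..<n} (\<lambda>_. \<pi>))"
proof -
  interpret P: prob_space \<pi> using \<pi> by (simp add: nprior_def)
  have sets_\<pi> [measurable_cong]: "sets \<pi> = sets borel" using \<pi> by (simp add: nprior_def)
  have sets_P [measurable_cong]: "sets (PiM J (\<lambda>_. \<pi>)) = sets (PiM J (\<lambda>_. borel))" for J :: "nat set"
    by (rule sets_PiM_eq_borel[OF sets_\<pi>])
  interpret E: prob_space "expo 1" by (rule prob_space_expo) simp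
  interpret PP: product_prob_space "\<lambda>_::nat. \<pi>" by (rule product_prob_spaceI) (rule P.prob_space_axioms)
  interpret EE: product_prob_space "\<lambda>_::nat. expo 1" by (rule product_prob_spaceI) (rule E.prob_space_axioms)
  define J where "J = {..<n} - {i}"
  have J: "finite J" "i \<notin> J" "{..<n} = insert i J" using i by (auto simp: J_def)
  interpret PJ: prob_space "PiM J (\<lambda>_. \<pi>)" by (rule prob_space_PiM) (rule P.prob_space_axioms)
  interpret EJ: prob_space "PiM J (\<lambda>_. expo 1)" by (rule prob_space_std_expo)
  interpret EN: prob_space "std_expo n" by (rule prob_space_std_expo)
  interpret PE: pair_sigma_finite \<pi> "PiM J (\<lambda>_. expo 1)" ..
  let ?F = "\<lambda>\<mu> e. ennreal ((g (scale n \<mu> e) - ln (\<mu> i))\<^sup>2)"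
  have F: "(\<lambda>z. ?F (u z) (v z)) \<in> borel_measurable M"
    if u: "u \<in> measurable M (RV n)" and v: "v \<in> measurable M (RV n)" for u v and M :: "'z measure"
  proof -
    have [measurable]: "(\<lambda>z. g (scale n (u z) (v z))) \<in> borel_measurable M"
      by (rule measurable_compose[OF measurable_scale[OF u v] g])
    have [measurable]: "(\<lambda>z. u z i) \<in> borel_measurable M"
      by (rule measurable_compose[OF u measurable_component_singleton]) (use i in simp)
    show ?thesis by measurable
  qed
  have upd: "(\<lambda>z. (u z)(i := v z)) \<in> measurable M (RV n)"
    if "u \<in> measurable M (PiM J (\<lambda>_. borel))" "v \<in> borel_measurable M"
    for u :: "'z \<Rightarrow> nat \<Rightarrow> real" and v and M :: "'z measure"
    unfolding J(3) by (rule measurable_fun_upd[where J=J]) (use that in auto)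
  have inner: "min_ubayes \<pi> \<le> (\<integral>\<^sup>+ m. \<integral>\<^sup>+ e. ?F (y(i := m)) (e'(i := e)) \<partial>expo 1 \<partial>\<pi>)"
    if y: "y \<in> space (PiM J (\<lambda>_. borel))" and e': "e' \<in> space (PiM J (\<lambda>_. borel))" for y e' :: "nat \<Rightarrow> real"
  proof -
    define d where "d x = g ((\<lambda>j\<in>J. y j * e' j)(i := x))" for x
    have dm: "d \<in> borel_measurable borel"
      unfolding d_def by (rule measurable_compose[OF upd g]) (auto simp: space_PiM)
    \<comment> \<open>The free parameter and its noise enter \<open>g\<close> only through the
      observation \<open>m * e\<close>, which is what makes \<open>d\<close> a rule of the
      one-dimensional problem.\<close>
    have sc: "scale n (y(i := m)) (e'(i := e)) = (\<lambda>j\<in>J. y j * e' j)(i := m * e)" for m e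
      using J(2,3) by (auto simp: scale_def fun_eq_iff)
    have "min_ubayes \<pi> \<le> ubayes d \<pi>"
      unfolding min_ubayes_def by (rule INF_lower[OF dm])
    also have "\<dots> = (\<integral>\<^sup>+ m. \<integral>\<^sup>+ e. ?F (y(i := m)) (e'(i := e)) \<partial>expo 1 \<partial>\<pi>)"
      unfolding ubayes_def
    proof (rule nn_integral_cong_AE)
      have "AE m in \<pi>. 1 \<le> m" using \<pi> by (simp add: nprior_def)
      then show "AE m in \<pi>. urisk d m = (\<integral>\<^sup>+ e. ?F (y(i := m)) (e'(i := e)) \<partial>expo 1)"
        by eventually_elim (simp add: urisk_eq_scaled dm sc d_def)
    qed
    finally show ?thesis .
  qed
  have "min_ubayes \<pi> = (\<integral>\<^sup>+ y. \<integral>\<^sup>+ e'. min_ubayes \<pi> \<partial>PiM J (\<lambda>_. expo 1) \<partial>PiM J (\<lambda>_. \<pi>))"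
    by (simp add: PJ.emeasure_space_1 EJ.emeasure_space_1)
  also have "\<dots> \<le> (\<integral>\<^sup>+ y. \<integral>\<^sup>+ e'. \<integral>\<^sup>+ m. \<integral>\<^sup>+ e. ?F (y(i := m)) (e'(i := e)) \<partial>expo 1 \<partial>\<pi> \<partial>PiM J (\<lambda>_. expo 1) \<partial>PiM J (\<lambda>_. \<pi>))"
    by (intro nn_integral_mono inner) (simp_all add: sets_eq_imp_space_eq[OF sets_P] space_PiM_expo)
  \<comment> \<open>Exchanging \<open>e'\<close> and \<open>m\<close> puts the two noise integrals
    next to each other, and likewise the two parameter integrals, so that each pair merges into one
    integral over n coordinates.\<close>
  also have "\<dots> = (\<integral>\<^sup>+ y. \<integral>\<^sup>+ m. \<integral>\<^sup>+ e'. \<integral>\<^sup>+ e. ?F (y(i := m)) (e'(i := e)) \<partial>expo 1 \<partial>PiM J (\<lambda>_. expo 1) \<partial>\<pi> \<partial>PiM J (\<lambda>_. \<pi>))"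
  proof (rule nn_integral_cong)
    fix y assume "y \<in> space (PiM J (\<lambda>_. \<pi>))"
    then have y: "y \<in> space (PiM J (\<lambda>_. borel))" by (simp add: sets_eq_imp_space_eq[OF sets_P])
    have "(\<lambda>w. ?F (y(i := fst (fst w))) ((snd (fst w))(i := snd w))) \<in>
        borel_measurable ((\<pi> \<Otimes>\<^sub>M PiM J (\<lambda>_. expo 1)) \<Otimes>\<^sub>M expo 1)"
      by (intro F upd measurable_const y) measurable
    then have "(\<lambda>z. \<integral>\<^sup>+ e. ?F (y(i := fst z)) ((snd z)(i := e)) \<partial>expo 1) \<in> borel_measurable (\<pi> \<Otimes>\<^sub>M PiM J (\<lambda>_. expo 1))"
      by (intro E.borel_measurable_nn_integral) (simp add: case_prod_beta')
    then show "(\<integral>\<^sup>+ e'. \<integral>\<^sup>+ m. \<integral>\<^sup>+ e. ?F (y(i := m)) (e'(i := e)) \<partial>expo 1 \<partial>\<pi> \<partial>PiM J (\<lambda>_. expo 1)) =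
        (\<integral>\<^sup>+ m. \<integral>\<^sup>+ e'. \<integral>\<^sup>+ e. ?F (y(i := m)) (e'(i := e)) \<partial>expo 1 \<partial>PiM J (\<lambda>_. expo 1) \<partial>\<pi>)"
      by (intro PE.Fubini') (simp add: case_prod_beta')
  qed
  also have "\<dots> = (\<integral>\<^sup>+ y. \<integral>\<^sup>+ m. \<integral>\<^sup>+ e. ?F (y(i := m)) e \<partial>std_expo n \<partial>\<pi> \<partial>PiM J (\<lambda>_. \<pi>))"
  proof (intro nn_integral_cong)
    fix y m assume "y \<in> space (PiM J (\<lambda>_. \<pi>))"
    then have y: "y \<in> space (PiM J (\<lambda>_. borel))" by (simp add: sets_eq_imp_space_eq[OF sets_P])
    have ym: "y(i := m) \<in> space (RV n)"
      using y unfolding J(3) by (auto simp: space_PiM PiE_iff extensional_def)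
    have "(\<lambda>e. ?F (y(i := m)) e) \<in> borel_measurable (PiM (insert i J) (\<lambda>_. expo 1))"
      unfolding J(3)[symmetric] by (rule F) (use ym in \<open>auto simp: sets_PiM_expo cong: measurable_cong_sets\<close>)
    then show "(\<integral>\<^sup>+ e'. \<integral>\<^sup>+ e. ?F (y(i := m)) (e'(i := e)) \<partial>expo 1 \<partial>PiM J (\<lambda>_. expo 1)) = (\<integral>\<^sup>+ e. ?F (y(i := m)) e \<partial>std_expo n)"
      unfolding J(3) by (rule EE.product_nn_integral_insert[OF J(1,2), symmetric])
  qed
  also have "\<dots> = (\<integral>\<^sup>+ \<mu>. \<integral>\<^sup>+ e. ?F \<mu> e \<partial>std_expo n \<partial>PiM {..<n} (\<lambda>_. \<pi>))"
  proof -
    have "(\<lambda>z. ?F (fst z) (snd z)) \<in> borel_measurable (PiM {..<n} (\<lambda>_. \<pi>) \<Otimes>\<^sub>M std_expo n)"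
      by (rule F) measurable
    then have "(\<lambda>\<mu>. \<integral>\<^sup>+ e. ?F \<mu> e \<partial>std_expo n) \<in> borel_measurable (PiM {..<n} (\<lambda>_. \<pi>))"
      by (intro EN.borel_measurable_nn_integral) (simp add: case_prod_beta')
    then show ?thesis
      unfolding J(3) by (rule PP.product_nn_integral_insert[OF J(1,2), symmetric])
  qed
  finally show ?thesis .
qed

lemma iid_bayes_ge:
  assumes \<pi>: "nprior \<pi>" and est: "est \<in> estimators n" and n: "0 < n"
  shows "min_ubayes \<pi> \<le> (\<integral>\<^sup>+ \<mu>. scaled_risk n est \<mu> \<partial>PiM {..<n} (\<lambda>_. \<pi>))"
proof -
  have sets_\<pi>: "sets \<pi> = sets borel" using \<pi> by (simp add: nprior_def)
  have sets_P [measurable_cong]: "sets (PiM {..<n} (\<lambda>_. \<pi>)) = sets (RV n)"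
    by (rule sets_PiM_eq_borel[OF sets_\<pi>])
  interpret EN: prob_space "std_expo n" by (rule prob_space_std_expo)
  let ?g = "\<lambda>i x. ln (est x i)"
  let ?F = "\<lambda>i \<mu> e. (?g i (scale n \<mu> e) - ln (\<mu> i))\<^sup>2"
  have g: "?g i \<in> borel_measurable (RV n)" if "i < n" for i
    using est that by (auto simp: estimators_iff)
  have F: "(\<lambda>z. ?F i (u z) (v z)) \<in> borel_measurable M"
    if u: "u \<in> measurable M (RV n)" and v: "v \<in> measurable M (RV n)" and i: "i < n" for u v i and M :: "'z measure"
  proof -
    have [measurable]: "(\<lambda>z. ?g i (scale n (u z) (v z))) \<in> borel_measurable M"
      by (rule measurable_compose[OF measurable_scale[OF u v] g[OF i]])
    have [measurable]: "(\<lambda>z. u z i) \<in> borel_measurable M"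
      by (rule measurable_compose[OF u measurable_component_singleton]) (use i in simp)
    show ?thesis by measurable
  qed
  have Fm: "(\<lambda>\<mu>. \<integral>\<^sup>+ e. ennreal (?F i \<mu> e) \<partial>std_expo n) \<in> borel_measurable (PiM {..<n} (\<lambda>_. \<pi>))" if "i < n" for i
  proof -
    have [measurable]: "(\<lambda>z. ?F i (fst z) (snd z)) \<in> borel_measurable (PiM {..<n} (\<lambda>_. \<pi>) \<Otimes>\<^sub>M std_expo n)"
      by (rule F[OF _ _ that]) measurable
    show ?thesis
      by (intro EN.borel_measurable_nn_integral) (simp add: case_prod_beta')
  qed
  have "min_ubayes \<pi> = (\<Sum>i<n. min_ubayes \<pi>) / ennreal (real n)"
  proof -
    have "min_ubayes \<pi> * ennreal (real n) / ennreal (real n) = min_ubayes \<pi>"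
      by (rule ennreal_mult_divide_eq) (use n in auto)
    then show ?thesis by (simp add: ennreal_of_nat_eq_real_of_nat mult.commute)
  qed
  also have "\<dots> \<le> (\<Sum>i<n. \<integral>\<^sup>+ \<mu>. \<integral>\<^sup>+ e. ennreal (?F i \<mu> e) \<partial>std_expo n \<partial>PiM {..<n} (\<lambda>_. \<pi>)) / ennreal (real n)"
    by (intro divide_right_mono_ennreal sum_mono coordinate_bayes_ge[OF \<pi> g]) auto
  also have "\<dots> = (\<integral>\<^sup>+ \<mu>. (\<Sum>i<n. \<integral>\<^sup>+ e. ennreal (?F i \<mu> e) \<partial>std_expo n) / ennreal (real n) \<partial>PiM {..<n} (\<lambda>_. \<pi>))"
  proof -
    have "(\<Sum>i<n. \<integral>\<^sup>+ \<mu>. \<integral>\<^sup>+ e. ennreal (?F i \<mu> e) \<partial>std_expo n \<partial>PiM {..<n} (\<lambda>_. \<pi>)) =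
        (\<integral>\<^sup>+ \<mu>. (\<Sum>i<n. \<integral>\<^sup>+ e. ennreal (?F i \<mu> e) \<partial>std_expo n) \<partial>PiM {..<n} (\<lambda>_. \<pi>))"
      by (rule nn_integral_sum[symmetric]) (use Fm in auto)
    then show ?thesis
      using Fm by (simp add: nn_integral_divide borel_measurable_sum)
  qed
  also have "\<dots> = (\<integral>\<^sup>+ \<mu>. scaled_risk n est \<mu> \<partial>PiM {..<n} (\<lambda>_. \<pi>))"
  proof (rule nn_integral_cong)
    fix \<mu> assume "\<mu> \<in> space (PiM {..<n} (\<lambda>_. \<pi>))"
    then have \<mu>: "\<mu> \<in> space (RV n)" by (simp add: sets_eq_imp_space_eq[OF sets_P])
    show "(\<Sum>i<n. \<integral>\<^sup>+ e. ennreal (?F i \<mu> e) \<partial>std_expo n) / ennreal (real n) = scaled_risk n est \<mu>"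
      unfolding scaled_risk_def log_loss_def
      by (rule nn_integral_mean[symmetric, OF n])
         (auto intro!: F measurable_const[OF \<mu>] simp: sets_PiM_expo cong: measurable_cong_sets)
  qed
  finally show ?thesis .
qed

section \<open>Concentration of product priors on the parameter set\<close>

lemma iid_budget_tail:
  assumes \<pi>: "nprior \<pi>" and T: "1 < T" "AE m in \<pi>. m \<le> T" and "0 < p" and n: "0 < n"
    and B: "(\<integral>\<^sup>+ m. ennreal (ln m powr p) \<partial>\<pi>) \<le> ennreal B" "0 \<le> B" and \<epsilon>: "0 \<le> \<epsilon>"
  shows "measure (PiM {..<n} (\<lambda>_. \<pi>))
      {\<mu> \<in> space (PiM {..<n} (\<lambda>_. \<pi>)). B + \<epsilon> < (1 / real n) * (\<Sum>i<n. ln (\<mu> i) powr p)}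
    \<le> exp (- 2 * real n * \<epsilon>\<^sup>2 / (ln T powr p)\<^sup>2)"
proof -
  let ?P = "PiM {..<n} (\<lambda>_. \<pi>)"
  interpret P: prob_space \<pi> using \<pi> by (simp add: nprior_def)
  have sets_\<pi> [measurable_cong]: "sets \<pi> = sets borel" using \<pi> by (simp add: nprior_def)
  have ae: "AE m in \<pi>. 1 \<le> m" using \<pi> by (simp add: nprior_def)
  interpret PN: prob_space ?P by (rule prob_space_PiM) (rule P.prob_space_axioms)
  have comp: "(\<lambda>\<mu>. \<mu> i) \<in> measurable ?P \<pi>" if "i < n" for i
    using that by (intro measurable_component_singleton) simp
  define L where "L m = ln m powr p" for m :: real
  have Lm [measurable]: "L \<in> borel_measurable borel" unfolding L_def by measurable
  have Lp: "L \<in> borel_measurable \<pi>" by measurable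
  have L_ae: "AE m in \<pi>. L m \<in> {0..ln T powr p}"
    using ae T(2) by eventually_elim (use \<open>0 < p\<close> in \<open>auto simp: L_def intro!: powr_mono2\<close>)
  have "PN.indep_vars (\<lambda>_. \<pi>) (\<lambda>i \<mu>. \<mu> i) {..<n}"
  proof (subst PN.indep_vars_iff_distr_eq_PiM')
    show "distr ?P ?P (\<lambda>x. \<lambda>i\<in>{..<n}. x i) = (\<Pi>\<^sub>M i\<in>{..<n}. distr ?P \<pi> (\<lambda>\<mu>. \<mu> i))"
    proof -
      have "distr ?P ?P (\<lambda>x. \<lambda>i\<in>{..<n}. x i) = distr ?P ?P (\<lambda>x. x)"
        by (rule distr_cong) (auto simp: space_PiM)
      also have "\<dots> = ?P" by (rule distr_id)
      also have "\<dots> = (\<Pi>\<^sub>M i\<in>{..<n}. distr ?P \<pi> (\<lambda>\<mu>. \<mu> i))"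
        by (rule PiM_cong) (simp_all add: distr_PiM_component[where M="\<lambda>_. \<pi>"] P.prob_space_axioms)
      finally show ?thesis .
    qed
  qed (use n comp in auto)
  then have indep: "PN.indep_vars (\<lambda>_. borel) (\<lambda>i \<mu>. L (\<mu> i)) {..<n}"
    by (rule PN.indep_vars_compose2) (rule Lp)
  have dist: "distr ?P borel (\<lambda>\<mu>. L (\<mu> i)) = distr \<pi> borel L" if "i < n" for i
  proof -
    have "distr \<pi> borel L = distr (distr ?P \<pi> (\<lambda>\<mu>. \<mu> i)) borel L"
      using that by (subst distr_PiM_component) (auto simp: P.prob_space_axioms)
    also have "\<dots> = distr ?P borel (\<lambda>\<mu>. L (\<mu> i))"
      by (subst distr_distr[OF Lp comp[OF that]]) (simp add: comp_def)
    finally show ?thesis ..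
  qed
  \<comment> \<open>The summands \<open>L (\<mu> i)\<close> lie between 0 and
    \<open>ln T powr p\<close>; coordinate 0, which exists because n is positive, represents their
    common law. Their mean is at most \<open>B\<close>, so exceeding \<open>B + \<epsilon>\<close>
    is a deviation by at least \<open>\<epsilon>\<close>.\<close>
  interpret H: Hoeffding_ineq_iid ?P "{..<n}" "\<lambda>i \<mu>. L (\<mu> i)" "\<lambda>\<mu>. L (\<mu> 0)" 0 "ln T powr p" "PN.expectation (\<lambda>\<mu>. L (\<mu> 0))"
  proof unfold_locales
    show "AE \<mu> in ?P. L (\<mu> 0) \<in> {0..ln T powr p}"
      by (rule AE_PiM_component[where P="\<lambda>m. L m \<in> {0..ln T powr p}"]) (use n L_ae in \<open>auto simp: P.prob_space_axioms\<close>)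
    show "(\<lambda>\<mu>. L (\<mu> 0)) \<in> borel_measurable ?P"
      by (rule measurable_compose[OF comp[OF n] Lp])
  qed (use indep dist n in auto)
  have ex: "PN.expectation (\<lambda>\<mu>. L (\<mu> 0)) \<le> B"
  proof -
    have "PN.expectation (\<lambda>\<mu>. L (\<mu> 0)) = enn2real (\<integral>\<^sup>+ \<mu>. ennreal (L (\<mu> 0)) \<partial>?P)"
      by (rule integral_eq_nn_integral[OF H.rv_Y]) (simp add: L_def)
    also have "(\<integral>\<^sup>+ \<mu>. ennreal (L (\<mu> 0)) \<partial>?P) = (\<integral>\<^sup>+ m. ennreal (L m) \<partial>\<pi>)"
      by (rule nn_integral_PiM_component[where M="\<lambda>_. \<pi>"]) (use n in \<open>auto simp: P.prob_space_axioms\<close>)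
    also have "enn2real \<dots> \<le> B"
      using enn2real_mono[OF B(1)] B(2) by (simp add: L_def)
    finally show ?thesis .
  qed
  have "measure ?P {\<mu> \<in> space ?P. B + \<epsilon> < (1 / real n) * (\<Sum>i<n. ln (\<mu> i) powr p)} \<le>
      measure ?P {\<mu> \<in> space ?P. (\<Sum>i<n. L (\<mu> i)) / real (card {..<n}) \<ge> PN.expectation (\<lambda>\<mu>. L (\<mu> 0)) + \<epsilon>}"
  proof (rule PN.finite_measure_mono)
    have "(\<lambda>\<mu>. L (\<mu> i)) \<in> borel_measurable ?P" if "i < n" for i
      by (rule measurable_compose[OF comp[OF that] Lp])
    then have [measurable]: "(\<lambda>\<mu>. \<Sum>i<n. L (\<mu> i)) \<in> borel_measurable ?P"
      by (intro borel_measurable_sum) auto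
    show "{\<mu> \<in> space ?P. (\<Sum>i<n. L (\<mu> i)) / real (card {..<n}) \<ge> PN.expectation (\<lambda>\<mu>. L (\<mu> 0)) + \<epsilon>} \<in> sets ?P"
      by measurable
  qed (use ex in \<open>auto simp: L_def\<close>)
  also have "\<dots> \<le> exp (- 2 * real (card {..<n}) * \<epsilon>\<^sup>2 / (ln T powr p - 0)\<^sup>2)"
    by (rule H.Hoeffding_ineq_ge'[OF \<epsilon>]) (use T n in auto)
  finally show ?thesis by simp
qed

subsection \<open>Lower bound for the minimax risk\<close>

lemma le_INF_add_ennreal:
  fixes a c :: ennreal
  assumes "\<And>x. x \<in> I \<Longrightarrow> a \<le> f x + c"
  shows "a \<le> (INF x\<in>I. f x) + c"
proof (cases "c = top")
  case False
  have "a - c \<le> (INF x\<in>I. f x)"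
    using assms False by (intro INF_greatest) (auto simp: ennreal_minus_le_iff add.commute)
  then show ?thesis using False by (auto simp: ennreal_minus_le_iff add.commute)
qed simp

text \<open>Each \<open>ln (a i)\<close> is projected onto \<open>[0, ln T]\<close>, which contains
  \<open>ln (\<mu> i)\<close>: the distance does not grow, and it is at most the length of the
  interval. The second bound caps the loss on the rare event that the parameter is over
  budget.\<close>

lemma clamped_log_loss_le:
  assumes T: "1 \<le> T" and \<mu>: "\<And>i. i < n \<Longrightarrow> 1 \<le> \<mu> i \<and> \<mu> i \<le> T" and n: "0 < n"
  shows "log_loss n (\<lambda>i. exp (max 0 (min (ln T) (ln (a i))))) \<mu> \<le> log_loss n a \<mu>"
    and "log_loss n (\<lambda>i. exp (max 0 (min (ln T) (ln (a i))))) \<mu> \<le> (ln T)\<^sup>2"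
proof -
  have b: "0 \<le> ln (\<mu> i)" "ln (\<mu> i) \<le> ln T" if "i < n" for i
    using \<mu>[OF that] by auto
  have 1: "(max 0 (min (ln T) (ln (a i))) - ln (\<mu> i))\<^sup>2 \<le> (ln (a i) - ln (\<mu> i))\<^sup>2" if "i < n" for i
  proof -
    have "\<bar>max 0 (min (ln T) (ln (a i))) - ln (\<mu> i)\<bar> \<le> \<bar>ln (a i) - ln (\<mu> i)\<bar>"
      using b[OF that] by (auto simp: max_def min_def abs_if)
    then show ?thesis using abs_le_square_iff by blast
  qed
  have 2: "(max 0 (min (ln T) (ln (a i))) - ln (\<mu> i))\<^sup>2 \<le> (ln T)\<^sup>2" if "i < n" for i
  proof -
    have "\<bar>max 0 (min (ln T) (ln (a i))) - ln (\<mu> i)\<bar> \<le> \<bar>ln T\<bar>"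
      using b[OF that] by (auto simp: max_def min_def abs_if)
    then show ?thesis using abs_le_square_iff by blast
  qed
  show "log_loss n (\<lambda>i. exp (max 0 (min (ln T) (ln (a i))))) \<mu> \<le> log_loss n a \<mu>"
    unfolding log_loss_def using 1 by (intro mult_left_mono sum_mono) auto
  have "(\<Sum>i<n. (max 0 (min (ln T) (ln (a i))) - ln (\<mu> i))\<^sup>2) \<le> (\<Sum>i<n. (ln T)\<^sup>2)"
    using 2 by (intro sum_mono) auto
  then show "log_loss n (\<lambda>i. exp (max 0 (min (ln T) (ln (a i))))) \<mu> \<le> (ln T)\<^sup>2"
    unfolding log_loss_def using n by (simp add: field_simps)
qed

text \<open>The Bayes risk of the clamped estimator under the product prior splits in two: on
  \<open>Mset\<close> it is at most the worst risk of \<open>est\<close>, off \<open>Mset\<close> at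
  most \<open>(ln T)\<^sup>2\<close> times the probability of exceeding the budget.\<close>

lemma minimax_risk_ge_iid:
  assumes \<pi>: "nprior \<pi>" and T: "1 < T" "AE m in \<pi>. m \<le> T" and "0 < p" and n: "0 < n"
    and B: "(\<integral>\<^sup>+ m. ennreal (ln m powr p) \<partial>\<pi>) \<le> ennreal B" "0 \<le> B" "B \<le> \<eta> powr p"
  shows "min_ubayes \<pi> \<le> minimax_risk n p \<eta> +
    ennreal ((ln T)\<^sup>2 * exp (- 2 * real n * (\<eta> powr p - B)\<^sup>2 / (ln T powr p)\<^sup>2))"
proof -
  let ?P = "PiM {..<n} (\<lambda>_. \<pi>)"
  let ?r = "exp (- 2 * real n * (\<eta> powr p - B)\<^sup>2 / (ln T powr p)\<^sup>2)"
  \<comment> \<open>The threshold is \<open>\<eta> powr p\<close>, written as \<open>B\<close> plus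
    the slack to match \<open>iid_budget_tail\<close>. Up to a null set, exceeding it is the only
    way to leave \<open>Mset\<close>.\<close>
  let ?bad = "{\<mu> \<in> space ?P. B + (\<eta> powr p - B) < (1 / real n) * (\<Sum>i<n. ln (\<mu> i) powr p)}"
  interpret P: prob_space \<pi> using \<pi> by (simp add: nprior_def)
  interpret PN: prob_space ?P by (rule prob_space_PiM) (rule P.prob_space_axioms)
  have sets_\<pi> [measurable_cong]: "sets \<pi> = sets borel" using \<pi> by (simp add: nprior_def)
  have ae: "AE m in \<pi>. 1 \<le> m" using \<pi> by (simp add: nprior_def)
  have ae_P: "AE \<mu> in ?P. \<forall>i\<in>{..<n}. 1 \<le> \<mu> i \<and> \<mu> i \<le> T"
  proof (intro eventually_ball_finite ballI)
    fix i assume i: "i \<in> {..<n}"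
    have "AE m in \<pi>. 1 \<le> m \<and> m \<le> T" using ae T(2) by simp
    then show "AE \<mu> in ?P. 1 \<le> \<mu> i \<and> \<mu> i \<le> T"
      using i P.prob_space_axioms
      by (intro AE_PiM_component[where P="\<lambda>m. 1 \<le> m \<and> m \<le> T" and M="\<lambda>_. \<pi>" and I="{..<n}" and i=i])
  qed simp
  have bad: "?bad \<in> sets ?P"
  proof -
    have "(\<lambda>\<mu>. ln (\<mu> i) powr p) \<in> borel_measurable ?P" if "i < n" for i
    proof -
      have "(\<lambda>\<mu>. \<mu> i) \<in> measurable ?P \<pi>" using that by (intro measurable_component_singleton) simp
      then have [measurable]: "(\<lambda>\<mu>. \<mu> i) \<in> borel_measurable ?P"
        by (simp only: measurable_cong_sets[OF refl sets_\<pi>])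
      show ?thesis by measurable
    qed
    then have [measurable]: "(\<lambda>\<mu>. \<Sum>i<n. ln (\<mu> i) powr p) \<in> borel_measurable ?P"
      by (intro borel_measurable_sum) auto
    show ?thesis by measurable
  qed
  have "min_ubayes \<pi> \<le> (SUP \<mu>\<in>Mset n p \<eta>. risk n est \<mu>) + ennreal ((ln T)\<^sup>2 * ?r)"
    if est: "est \<in> estimators n" for est
  proof -
    define est' where "est' x i = exp (max 0 (min (ln T) (ln (est x i))))" for x i
    let ?W = "SUP \<mu>\<in>Mset n p \<eta>. risk n est \<mu>"
    have est': "est' \<in> estimators n"
      using est by (auto simp: estimators_iff est'_def)
    have "min_ubayes \<pi> \<le> (\<integral>\<^sup>+ \<mu>. scaled_risk n est' \<mu> \<partial>?P)"
      by (rule iid_bayes_ge[OF \<pi> est' n])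
    also have "\<dots> \<le> (\<integral>\<^sup>+ \<mu>. ?W + ennreal ((ln T)\<^sup>2) * indicator ?bad \<mu> \<partial>?P)"
    proof (rule nn_integral_mono_AE, use ae_P AE_space in eventually_elim)
      case (elim \<mu>)
      then have \<mu>: "1 \<le> \<mu> i \<and> \<mu> i \<le> T" if "i < n" for i using that by auto
      show ?case
      proof (cases "\<mu> \<in> ?bad")
        case True
        interpret EN: prob_space "std_expo n" by (rule prob_space_std_expo)
        have "scaled_risk n est' \<mu> \<le> (\<integral>\<^sup>+ e. ennreal ((ln T)\<^sup>2) \<partial>std_expo n)"
          unfolding scaled_risk_def est'_def
          using T by (intro nn_integral_mono ennreal_leI clamped_log_loss_le \<mu> n) auto
        also have "\<dots> = ennreal ((ln T)\<^sup>2)" by (simp add: EN.emeasure_space_1)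
        finally show ?thesis using True by (simp add: add_increasing)
      next
        case False
        then have M: "\<mu> \<in> Mset n p \<eta>" using elim(2) \<mu> by (auto simp: Mset_def)
        have "scaled_risk n est' \<mu> \<le> scaled_risk n est \<mu>"
          unfolding scaled_risk_def est'_def
          using T by (intro nn_integral_mono ennreal_leI clamped_log_loss_le \<mu> n) auto
        also have "\<dots> = risk n est \<mu>"
          unfolding scaled_risk_def
          by (rule risk_eq_scaled[OF est, symmetric]) (use \<mu> in \<open>force intro: less_le_trans[OF zero_less_one]\<close>)
        also have "\<dots> \<le> ?W" by (rule SUP_upper[OF M])
        finally show ?thesis using False by simp
      qed
    qed
    also have "\<dots> = ?W + ennreal ((ln T)\<^sup>2) * emeasure ?P ?bad"
      using bad by (subst nn_integral_add) (auto simp: nn_integral_cmult_indicator PN.emeasure_space_1)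
    also have "\<dots> \<le> ?W + ennreal ((ln T)\<^sup>2) * ennreal ?r"
      unfolding PN.emeasure_eq_measure
      using iid_budget_tail[OF \<pi> T \<open>0 < p\<close> n B(1,2), of "\<eta> powr p - B"] B(3)
      by (intro add_left_mono mult_left_mono ennreal_leI) auto
    finally show ?thesis by (simp add: ennreal_mult)
  qed
  then show ?thesis
    unfolding minimax_risk_def by (rule le_INF_add_ennreal)
qed

section \<open>Truncated priors with slack in the constraint\<close>

definition truncated_prior :: "real \<Rightarrow> real \<Rightarrow> real measure \<Rightarrow> real measure" where
  "truncated_prior t T \<pi> = mix2 t (return borel 1) (distr \<pi> borel (\<lambda>m. if m \<le> T then m else 1))"

text \<open>Mass above \<open>T\<close> is moved to 1, where \<open>ln\<close> vanishes, so the
  moment cannot grow; the weight \<open>t\<close> at 1 then scales the budget by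
  \<open>1 - t\<close>. For the Bayes risk, clamp a given rule and evaluate it under
  \<open>\<pi>\<close>: up to \<open>T\<close> clamping adds at most \<open>ln_tail A\<close>, above
  \<open>T\<close> the risk is at most \<open>close_bound A\<close>. The factor \<open>1 - t\<close>
  is the share of the truncated law in the mixture.\<close>

lemma
  assumes \<pi>: "\<pi> \<in> upriors p \<eta>" and t: "0 \<le> t" "t \<le> 1" and T: "1 \<le> T" and A: "0 \<le> A"
  shows nprior_truncated: "nprior (truncated_prior t T \<pi>)"
    and truncated_le: "AE m in truncated_prior t T \<pi>. m \<le> T"
    and truncated_budget: "(\<integral>\<^sup>+ m. ennreal (ln m powr p) \<partial>truncated_prior t T \<pi>) \<le> ennreal ((1 - t) * \<eta> powr p)"
    and min_ubayes_truncated: "ennreal (1 - t) * min_ubayes \<pi> \<le>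
      min_ubayes (truncated_prior t T \<pi>) + ln_tail A + ennreal (close_bound A * measure \<pi> {T<..})"
proof -
  let ?f = "\<lambda>m::real. if m \<le> T then m else 1"
  let ?\<rho> = "distr \<pi> borel ?f"
  have n\<pi>: "nprior \<pi>" by (rule upriors_nprior[OF \<pi>])
  interpret P: prob_space \<pi> using n\<pi> by (simp add: nprior_def)
  have sets_\<pi> [measurable_cong]: "sets \<pi> = sets borel" using n\<pi> by (simp add: nprior_def)
  have ae: "AE m in \<pi>. 1 \<le> m" using n\<pi> by (simp add: nprior_def)
  have fm [measurable]: "?f \<in> borel_measurable \<pi>" by measurable
  have r1: "nprior (return borel 1)"
    by (auto simp: nprior_def AE_return intro!: prob_space_return)
  have \<rho>1: "AE m in ?\<rho>. 1 \<le> m"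
    using ae by (subst AE_distr_iff) (auto elim!: eventually_mono)
  have \<rho>: "nprior ?\<rho>"
    using \<rho>1 by (auto simp: nprior_def intro!: P.prob_space_distr)
  have \<rho>': "prob_space ?\<rho>" "sets ?\<rho> = sets borel" and r1': "prob_space (return borel (1::real))" "sets (return borel (1::real)) = sets borel"
    using \<rho> r1 by (auto simp: nprior_def)
  note mm = t \<rho>' r1'
  show "nprior (truncated_prior t T \<pi>)"
    unfolding truncated_prior_def by (rule nprior_mix2[OF t \<rho> r1])
  show "AE m in truncated_prior t T \<pi>. m \<le> T"
    unfolding truncated_prior_def
  proof (rule AE_mix2[OF mm])
    show "AE m in return borel 1. m \<le> T" using T by (subst AE_return) auto
    show "AE m in ?\<rho>. m \<le> T" using T by (subst AE_distr_iff) auto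
  qed simp
  have "(\<integral>\<^sup>+ m. ennreal (ln m powr p) \<partial>truncated_prior t T \<pi>) =
      ennreal t * (\<integral>\<^sup>+ m. ennreal (ln m powr p) \<partial>return borel 1) + ennreal (1 - t) * (\<integral>\<^sup>+ m. ennreal (ln m powr p) \<partial>?\<rho>)"
    unfolding truncated_prior_def by (rule nn_integral_mix2[OF mm]) simp
  also have "\<dots> = ennreal (1 - t) * (\<integral>\<^sup>+ m. ennreal (ln (?f m) powr p) \<partial>\<pi>)"
    by (simp add: nn_integral_return nn_integral_distr)
  also have "\<dots> \<le> ennreal (1 - t) * (\<integral>\<^sup>+ m. ennreal (ln m powr p) \<partial>\<pi>)"
    by (intro mult_left_mono nn_integral_mono) auto
  also have "\<dots> \<le> ennreal (1 - t) * ennreal (\<eta> powr p)"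
    using \<pi> by (intro mult_left_mono) (auto simp: upriors_def)
  also have "\<dots> = ennreal ((1 - t) * \<eta> powr p)"
    using t by (simp add: ennreal_mult)
  finally show "(\<integral>\<^sup>+ m. ennreal (ln m powr p) \<partial>truncated_prior t T \<pi>) \<le> ennreal ((1 - t) * \<eta> powr p)" .

  have key: "ennreal (1 - t) * min_ubayes \<pi> \<le>
      ubayes d (truncated_prior t T \<pi>) + (ln_tail A + ennreal (close_bound A * measure \<pi> {T<..}))"
    if [measurable]: "d \<in> borel_measurable borel" for d
  proof -
    let ?c = "clampd A d" and ?s = "ln_tail A + ennreal (close_bound A * measure \<pi> {T<..})"
    have cl: "ln_close A ?c" by (rule ln_close_clampd[OF that A])
    then have [measurable]: "?c \<in> borel_measurable borel" by (simp add: ln_close_def)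
    have cb: "0 \<le> close_bound A" unfolding close_bound_def by (rule integral_nonneg_AE) simp
    have "min_ubayes \<pi> \<le> ubayes ?c \<pi>" unfolding min_ubayes_def by (rule INF_lower) simp
    also have "\<dots> \<le> (\<integral>\<^sup>+ m. urisk d (?f m) + ln_tail A + ennreal (close_bound A) * indicator {T<..} m \<partial>\<pi>)"
      unfolding ubayes_def
    proof (rule nn_integral_mono_AE, use ae in eventually_elim)
      case (elim m)
      show ?case
      proof (cases "m \<le> T")
        case True
        then show ?thesis using urisk_clampd_le[OF _ A that, of m] elim by simp
      next
        case False
        then show ?thesis using urisk_ln_close_le[OF cl, of m] elim by (simp add: add_increasing)
      qed
    qed
    also have "\<dots> = (\<integral>\<^sup>+ m. urisk d (?f m) \<partial>\<pi>) + ln_tail A + ennreal (close_bound A) * emeasure \<pi> {T<..}"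
      by (simp add: nn_integral_add nn_integral_cmult_indicator P.emeasure_space_1)
    also have "\<dots> = ubayes d ?\<rho> + ?s"
      using cb by (simp add: ubayes_def nn_integral_distr P.emeasure_eq_measure ennreal_mult add.assoc)
    finally have "ennreal (1 - t) * min_ubayes \<pi> \<le> ennreal (1 - t) * (ubayes d ?\<rho> + ?s)"
      by (rule mult_left_mono) simp
    also have "\<dots> = ennreal (1 - t) * ubayes d ?\<rho> + ennreal (1 - t) * ?s"
      by (rule distrib_left)
    also have "\<dots> \<le> ubayes d (truncated_prior t T \<pi>) + 1 * ?s"
    proof (intro add_mono mult_right_mono)
      show "ennreal (1 - t) * ubayes d ?\<rho> \<le> ubayes d (truncated_prior t T \<pi>)"
        unfolding truncated_prior_def by (subst ubayes_mix2[OF t \<rho> r1 that]) simp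
      show "ennreal (1 - t) \<le> 1" using t by simp
    qed simp
    finally show ?thesis by simp
  qed
  have "ennreal (1 - t) * min_ubayes \<pi> \<le>
      min_ubayes (truncated_prior t T \<pi>) + (ln_tail A + ennreal (close_bound A * measure \<pi> {T<..}))"
    unfolding min_ubayes_def[of "truncated_prior t T \<pi>"] by (rule le_INF_add_ennreal) (rule key)
  then show "ennreal (1 - t) * min_ubayes \<pi> \<le>
      min_ubayes (truncated_prior t T \<pi>) + ln_tail A + ennreal (close_bound A * measure \<pi> {T<..})"
    by (simp add: add.assoc)
qed

lemma near_least_favourable_truncated:
  assumes p: "0 < p" and \<eta>: "0 < \<eta>" and b: "maximin p \<eta> = ennreal b" and c: "0 \<le> c" "c < b"
  obtains \<pi> T B where "nprior \<pi>" "1 < T" "AE m in \<pi>. m \<le> T"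
    "(\<integral>\<^sup>+ m. ennreal (ln m powr p) \<partial>\<pi>) \<le> ennreal B" "0 \<le> B" "B < \<eta> powr p"
    "ennreal c \<le> min_ubayes \<pi>"
proof -
  obtain \<pi> where \<pi>: "\<pi> \<in> upriors p \<eta>" and lf: "maximin p \<eta> \<le> min_ubayes \<pi>"
    using least_favourable_exists[OF p \<eta>] by blast
  \<comment> \<open>The gap \<open>s\<close> pays for three losses of at most a quarter each: the
    mixing weight, the clamping tail and the truncated mass.\<close>
  define s where "s = b - c"
  have s: "0 < s" "s \<le> b" "0 < b" using c by (auto simp: s_def)
  define t where "t = s / (4 * b)"
  have t: "0 < t" "t \<le> 1" "t * b = s / 4" using s by (auto simp: t_def field_simps)
  have "\<forall>\<^sub>F k in sequentially. ln_tail (real k) < ennreal (s / 4)"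
    using order_tendstoD(2)[OF ln_tail_tendsto, of "ennreal (s / 4)"] s by simp
  then obtain k where k: "ln_tail (real k) < ennreal (s / 4)"
    by (auto simp: eventually_sequentially)
  define C where "C = close_bound (real k)"
  have C: "0 \<le> C" unfolding C_def close_bound_def by (rule integral_nonneg_AE) simp
  \<comment> \<open>\<open>C\<close> multiplies the truncated mass, so that mass has to be of order
    \<open>s / C\<close>; \<open>C + 1\<close> avoids division by 0. \<open>T\<close> is the tail
    threshold of \<open>upriors_tail\<close> for this \<open>\<epsilon>\<close>.\<close>
  define \<epsilon> where "\<epsilon> = s / (4 * (C + 1))"
  have \<epsilon>: "0 < \<epsilon>" "C * \<epsilon> \<le> s / 4" using C s by (auto simp: \<epsilon>_def field_simps)
  define T where "T = exp ((\<eta> powr p / \<epsilon>) powr (1 / p))"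
  have T: "1 < T" using \<epsilon> \<eta> by (simp add: T_def)
  have "measure \<pi> {T<..} \<le> \<epsilon>"
    unfolding T_def by (rule upriors_tail[OF \<pi> p \<eta> \<epsilon>(1)])
  then have CT: "C * measure \<pi> {T<..} \<le> s / 4"
    using mult_left_mono[of "measure \<pi> {T<..}" \<epsilon> C] C \<epsilon>(2) by linarith
  let ?\<rho> = "truncated_prior t T \<pi>"
  note tr = \<pi> less_imp_le[OF t(1)] t(2) less_imp_le[OF T]
  have "ennreal ((1 - t) * b) = ennreal (1 - t) * maximin p \<eta>"
    using t s by (simp add: b ennreal_mult)
  also have "\<dots> \<le> ennreal (1 - t) * min_ubayes \<pi>"
    by (rule mult_left_mono[OF lf]) simp
  also have "\<dots> \<le> min_ubayes ?\<rho> + ln_tail (real k) + ennreal (C * measure \<pi> {T<..})"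
    unfolding C_def by (rule min_ubayes_truncated[OF tr]) simp
  also have "\<dots> \<le> min_ubayes ?\<rho> + ennreal (s / 4) + ennreal (s / 4)"
    using k CT by (intro add_mono ennreal_leI) auto
  also have "\<dots> = min_ubayes ?\<rho> + ennreal (s / 2)"
    using s by (simp add: add.assoc ennreal_plus[symmetric] del: ennreal_plus)
  finally have le: "ennreal ((1 - t) * b) \<le> min_ubayes ?\<rho> + ennreal (s / 2)" .
  have "ennreal c \<le> min_ubayes ?\<rho>"
  proof (cases "min_ubayes ?\<rho>")
    case (real x)
    then have "(1 - t) * b \<le> x + s / 2"
      using le s by (simp add: ennreal_plus[symmetric] del: ennreal_plus)
    then have "b - s / 4 \<le> x + s / 2" using t(3) by (simp add: left_diff_distrib)
    then have "c \<le> x" using s(1) s_def by linarith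
    then show ?thesis using real by (simp add: ennreal_leI)
  qed simp
  moreover have "(1 - t) * \<eta> powr p < \<eta> powr p" using t \<eta> by (simp add: algebra_simps)
  moreover have "0 \<le> (1 - t) * \<eta> powr p" using t by simp
  ultimately show ?thesis
    using that[of ?\<rho> T "(1 - t) * \<eta> powr p"] nprior_truncated[OF tr order.refl] truncated_le[OF tr order.refl]
      truncated_budget[OF tr order.refl] T by blast
qed

section \<open>Convergence of both risks to the maximin value\<close>

lemma minimax_risk_eventually_ge:
  assumes p: "0 < p" and \<eta>: "0 < \<eta>" and b: "maximin p \<eta> = ennreal b" and c: "0 \<le> c" "c < b"
  shows "\<forall>\<^sub>F n in sequentially. ennreal c \<le> minimax_risk n p \<eta>"
proof -
  \<comment> \<open>Aiming at the midpoint of \<open>c\<close> and \<open>b\<close> leaves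
    \<open>(b - c) / 2\<close> to absorb the error \<open>r n\<close>.\<close>
  obtain \<pi> T B where \<pi>: "nprior \<pi>" and T: "1 < T" "AE m in \<pi>. m \<le> T"
    and B: "(\<integral>\<^sup>+ m. ennreal (ln m powr p) \<partial>\<pi>) \<le> ennreal B" "0 \<le> B" "B < \<eta> powr p"
    and c': "ennreal ((c + b) / 2) \<le> min_ubayes \<pi>"
    by (rule near_least_favourable_truncated[OF p \<eta> b, of "(c + b) / 2"]) (use c in auto)
  define r where "r n = (ln T)\<^sup>2 * exp (- 2 * real n * (\<eta> powr p - B)\<^sup>2 / (ln T powr p)\<^sup>2)" for n
  \<comment> \<open>Since \<open>T\<close> and \<open>B\<close> are fixed, the error is geometric in
    n, with ratio below 1 thanks to the slack \<open>B < \<eta> powr p\<close>.\<close>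
  have r_eq: "r n = (ln T)\<^sup>2 * exp (- 2 * (\<eta> powr p - B)\<^sup>2 / (ln T powr p)\<^sup>2) ^ n" for n
    unfolding r_def by (simp add: exp_of_nat_mult[symmetric])
  have "0 < 2 * (\<eta> powr p - B)\<^sup>2 / (ln T powr p)\<^sup>2"
    using B(3) T by (intro divide_pos_pos mult_pos_pos zero_less_power) auto
  then have "r \<longlonglongrightarrow> (ln T)\<^sup>2 * 0"
    unfolding r_eq[abs_def] by (intro tendsto_mult tendsto_const LIMSEQ_power_zero) simp
  then have "\<forall>\<^sub>F n in sequentially. r n < (b - c) / 2"
    by (rule order_tendstoD) (use c in simp)
  then show ?thesis
    using eventually_gt_at_top[of "0::nat"]
  proof eventually_elim
    case (elim n)
    have "ennreal ((c + b) / 2) \<le> minimax_risk n p \<eta> + ennreal (r n)"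
      using minimax_risk_ge_iid[OF \<pi> T p elim(2) B(1,2) less_imp_le[OF B(3)]] c'
      unfolding r_def by (rule order_trans[rotated])
    moreover have "0 \<le> r n" by (simp add: r_def)
    ultimately show ?case
      using elim(1) c
      by (cases "minimax_risk n p \<eta>")
         (auto simp: ennreal_plus[symmetric] field_simps simp del: ennreal_plus intro!: ennreal_leI)
  qed
qed

theorem theorem2p1:
  fixes p \<eta> :: real
  assumes "0 < p" and "p < 2" and "0 < \<eta>"
  shows "(\<lambda>n. enn2real (minimax_risk n p \<eta>) / enn2real (minimax_bayes_risk n p \<eta>))
           \<longlonglongrightarrow> 1"
proof -
  obtain b where b: "maximin p \<eta> = ennreal b" "0 < b"
    using maximin_finite[of p \<eta>] maximin_pos[OF assms(1,3)]
    by (cases "maximin p \<eta>") auto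
  let ?R = "\<lambda>n. enn2real (minimax_risk n p \<eta>)" and ?Q = "\<lambda>n. enn2real (minimax_bayes_risk n p \<eta>)"
  have Q: "minimax_bayes_risk n p \<eta> \<le> ennreal b" if "0 < n" for n
    using minimax_bayes_risk_le[OF that assms(1,3)] b by simp
  have RQ: "?R n \<le> ?Q n" "?Q n \<le> b" if "0 < n" for n
  proof -
    \<comment> \<open>\<open>enn2real\<close> sends \<open>top\<close> to 0, so finiteness has to
      precede monotonicity.\<close>
    have "minimax_bayes_risk n p \<eta> < top" using Q[OF that] by (rule le_less_trans) simp
    then show "?R n \<le> ?Q n" by (intro enn2real_mono minimax_risk_le_minimax_bayes_risk)
    show "?Q n \<le> b" using enn2real_mono[OF Q[OF that]] b by simp
  qed
  have low: "\<forall>\<^sub>F n in sequentially. c < ?R n" if "c < b" for c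
  proof -
    \<comment> \<open>The lower bound is available at non-negative levels and is not strict; the
      midpoint of \<open>max c 0\<close> and \<open>b\<close> handles both points.\<close>
    define c' where "c' = (max c 0 + b) / 2"
    have c': "c < c'" "0 \<le> c'" "c' < b" using that b by (auto simp: c'_def max_def)
    have "\<forall>\<^sub>F n in sequentially. ennreal c' \<le> minimax_risk n p \<eta>"
      by (rule minimax_risk_eventually_ge[OF assms(1,3) b(1) c'(2,3)])
    then show ?thesis
      using eventually_gt_at_top[of "0::nat"]
    proof eventually_elim
      case (elim n)
      have "minimax_risk n p \<eta> < top"
        using order_trans[OF minimax_risk_le_minimax_bayes_risk Q[OF elim(2)]] by (rule le_less_trans) simp
      then have "c' \<le> ?R n" using enn2real_mono[OF elim(1)] c' by simp
      then show ?case using c' by simp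
    qed
  qed
  have "?R \<longlonglongrightarrow> b"
  proof (rule order_tendstoI)
    fix c assume "b < c"
    have "\<forall>\<^sub>F n in sequentially. 0 < (n::nat)" by (rule eventually_gt_at_top)
    then show "\<forall>\<^sub>F n in sequentially. ?R n < c"
    proof eventually_elim
      case (elim n)
      then show ?case using RQ[OF elim] \<open>b < c\<close> by linarith
    qed
  qed (rule low)
  moreover have "?Q \<longlonglongrightarrow> b"
  proof (rule tendsto_sandwich[OF _ _ \<open>?R \<longlonglongrightarrow> b\<close> tendsto_const])
    show "\<forall>\<^sub>F n in sequentially. ?R n \<le> ?Q n" "\<forall>\<^sub>F n in sequentially. ?Q n \<le> b"
      by (rule eventually_mono[OF eventually_gt_at_top[of "0::nat"]], erule RQ)+
  qed
  ultimately have "(\<lambda>n. ?R n / ?Q n) \<longlonglongrightarrow> b / b"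
    using b by (intro tendsto_divide) auto
  then show ?thesis using b by simp
qed

end
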